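(* Let $p,q\ge1$, let $A=(a_{i_0,\dots,i_p})$ be a complex multidimensional matrix of format $(k_0+1)\times\dots\times(k_p+1)$ and $B=(b_{j_0,\dots,j_q})$ a complex multidimensional matrix of format $(l_0+1)\times\dots\times(l_q+1)$, both of boundary format, i.e. $k_0=\sum_{i=1}^pk_i$ and $l_0=\sum_{r=1}^q l_r$. Let $j\in\{1,\dots,q\}$ be such that $k_0=l_j$. Then $A$ and $B$ are both nondegenerate if and only if the convolution $A\ast_{0,j}B$ is nondegenerate.
   Context: A complex multidimensional matrix of format $(k_0+1)\times\dots\times(k_p+1)$ is a family $A=(a_{i_0,\dots,i_p})$ of complex numbers, $0\le i_r\le k_r$, where the $k_r$ are nonnegative integers. One index, written with subscript $0$, is distinguished. The matrix is of boundary format if $k_0=\sum_{i=1}^pk_i$. $A$ is degenerate if there are nonzero vectors $x^{(r)}=(x^{(r)}_0,\dots,x^{(r)}_{k_r})\in\mathbb C^{k_r+1}$, $r=1,\dots,p$, such that $\sum_{i_1,\dots,i_p}a_{i_0,i_1,\dots,i_p}x^{(1)}_{i_1}\cdots x^{(p)}_{i_p}=0$ for every $i_0\in\{0,\dots,k_0\}$; otherwise $A$ is nondegenerate. If $k_r=l_s$, the convolution $A\ast_{r,s}B$ is the $(p+q)$-index matrix obtained by identifying the $r$-th index of $A$ with the $s$-th index of $B$ and summing over their common value. In particular, for $k_0=l_j$ with $1\le j\le q$, $A\ast_{0,j}B$ has entries $$\sum_{h=0}^{k_0}a_{h,i_1,\dots,i_p}\;b_{j_0,\dots,j_{j-1},\,h,\,j_{j+1},\dots,j_q},$$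 where $h$ occupies the $j$-th index position of $B$. Its free indices are $i_1,\dots,i_p$ and all $j_r$ with $r\neq j$. Its distinguished index is $j_0$ (of size $l_0+1$), and with this choice it is again of boundary format, since $l_0=\sum_{r\ne j,\,r\ge1}l_r+\sum_{i=1}^pk_i$; nondegeneracy of $A\ast_{0,j}B$ is understood with respect to this distinguished index. *)

theory Defs
  imports Complex_Main
begin

text \<open>
  A matrix of format $(k_0+1)\times\dots\times(k_p+1)$ is given by the list $[k_0,\dots,k_p]$
  and a function on index lists $[i_0,\dots,i_p]$, of which only the values at the indices with
  $i_r \le k_r$ matter. The distinguished index is the one at position 0.
\<close>

type_synonym mdmatrix = "nat list \<Rightarrow> complex"

definition multi_indices :: "nat list \<Rightarrow> nat list set" where
  "multi_indices ks = {idx. length idx = length ks \<and> (\<forall>r<length ks. idx ! r \<le> ks ! r)}"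

definition boundary_format :: "nat list \<Rightarrow> bool" where
  "boundary_format ks \<longleftrightarrow> ks ! 0 = (\<Sum>r = 1..<length ks. ks ! r)"

text \<open>
  The vector $x^{(r)} \in \mathbb{C}^{k_r+1}$ is \<open>x r\<close>, restricted to the coordinates
  \<open>0, \<dots>, ks ! r\<close>; being nonzero refers to these coordinates.
\<close>

definition degenerate :: "nat list \<Rightarrow> mdmatrix \<Rightarrow> bool" where
  "degenerate ks A \<longleftrightarrow>
     (\<exists>x :: nat \<Rightarrow> nat \<Rightarrow> complex.
        (\<forall>r\<in>{1..<length ks}. \<exists>i\<le>ks ! r. x r i \<noteq> 0) \<and>
        (\<forall>i0\<le>ks ! 0.
           (\<Sum>idx\<in>{idx \<in> multi_indices ks. idx ! 0 = i0}.
              A idx * (\<Prod>r = 1..<length ks. x r (idx ! r))) = 0))"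

abbreviation nondegenerate :: "nat list \<Rightarrow> mdmatrix \<Rightarrow> bool" where
  "nondegenerate ks A \<equiv> \<not> degenerate ks A"

text \<open>
  Convolution of \<open>A\<close> (format \<open>ks\<close>) and \<open>B\<close> (format \<open>ls\<close>) along index \<open>r\<close> of \<open>A\<close> and index
  \<open>s\<close> of \<open>B\<close>. The free indices are listed as those of \<open>B\<close>, with the index at position \<open>s\<close>
  replaced by the block of the \<open>length ks - 1\<close> remaining indices of \<open>A\<close>:
  $$(j_0,\dots,j_{s-1},\; i_0,\dots,i_{r-1},i_{r+1},\dots,i_p,\; j_{s+1},\dots,j_q).$$
  Hence for \<open>s \<ge> 1\<close> the index at position 0, which is the distinguished one, is $j_0$.
\<close>

definition conv_format :: "nat list \<Rightarrow> nat list \<Rightarrow> nat \<Rightarrow> nat \<Rightarrow> nat list" where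
  "conv_format ks ls r s = take s ls @ (take r ks @ drop (Suc r) ks) @ drop (Suc s) ls"

definition convolution :: "nat list \<Rightarrow> nat \<Rightarrow> nat \<Rightarrow> mdmatrix \<Rightarrow> mdmatrix \<Rightarrow> mdmatrix" where
  "convolution ks r s A B = (\<lambda>idx.
     let p = length ks - 1;
         is = take p (drop s idx)
     in \<Sum>h\<le>ks ! r. A (take r is @ h # drop r is) * B (take s idx @ h # drop (s + p) idx))"

lemma convolution_0_apply:
  assumes "length ks = Suc p" "length is = p" "length js = s"
  shows "convolution ks 0 s A B (js @ is @ js') =
           (\<Sum>h\<le>ks ! 0. A (h # is) * B (js @ h # js'))"
  using assms by (simp add: convolution_def)

lemma boundary_format_conv_format:
  assumes "ks \<noteq> []" "1 \<le> j" "j < length ls" "ks ! 0 = ls ! j"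
    and "boundary_format ks" "boundary_format ls"
  shows "boundary_format (conv_format ks ls 0 j)"
proof -
  have bf: "boundary_format (k # xs) \<longleftrightarrow> k = sum_list xs" for k xs
    unfolding boundary_format_def
    using sum.shift_bounds_Suc_ivl[of "\<lambda>r. (k # xs) ! r" 0 "length xs"]
    by (simp add: sum_list_sum_nth del: sum.op_ivl_Suc sum.shift_bounds_Suc_ivl)
  obtain k ks' where ks: "ks = k # ks'" using assms(1) by (cases ks) auto
  obtain l ls' where ls: "ls = l # ls'" using assms(3) by (cases ls) auto
  obtain i where j: "j = Suc i" using assms(2) by (cases j) auto
  have "sum_list ls' = sum_list (take i ls') + ls' ! i + sum_list (drop (Suc i) ls')"
    using id_take_nth_drop[of i ls'] assms(3) ls j
    by (metis (no_types) Suc_less_eq add.assoc length_Cons sum_list.Cons sum_list.append)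
  then show ?thesis using assms unfolding conv_format_def ks ls j by (simp add: bf)
qed

end

theory Submission
  imports Defs "HOL-Library.Function_Algebras" "HOL-Library.FuncSet"
    "HOL-Computational_Algebra.Fundamental_Theorem_Algebra"
    "HOL-Analysis.Continuum_Not_Denumerable"
begin

text \<open>
  Contracting \<open>A * B\<close> with vectors amounts to contracting \<open>A\<close> with some of them, which gives a
  vector \<open>z\<close> of length \<open>k\<^sub>0 + 1 = l\<^sub>j + 1\<close>, and then \<open>B\<close> with \<open>z\<close> in position \<open>j\<close> and with the other
  vectors (\<open>contract_convolution\<close>). So \<open>A * B\<close> is degenerate as soon as \<open>A\<close> is, and if \<open>A * B\<close> is
  degenerate, then either \<open>z\<close> is zero and \<open>A\<close> is degenerate, or \<open>z\<close> is one of the vectors that make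
  \<open>B\<close> degenerate. What remains is that \<open>A * B\<close> is degenerate if \<open>B\<close> is: given the vector \<open>z\<close> that is
  used at position \<open>j\<close> of \<open>B\<close>, nonzero vectors are needed that \<open>A\<close> contracts to a multiple of \<open>z\<close>,
  possibly to zero (\<open>contraction_hits_every_line\<close>). Being a multiple of a given nonzero vector means
  \<open>k\<^sub>0\<close> linear conditions, hence \<open>k\<^sub>0\<close> multilinear equations on the product
  of the projective spaces of dimensions \<open>k\<^sub>1, \<dots>, k\<^sub>p\<close>. By the boundary format the number
  of equations is the dimension of that product, and so they have a common zero (\<open>common_zero\<close>).

  Geometrically, a common zero exists because the intersection number \<open>(H\<^sub>1 + \<dots> + H\<^sub>p)\<^sup>n\<close> of \<open>n\<close>
  divisors of multidegree \<open>(1, \<dots>, 1)\<close> on a product of dimension \<open>n\<close> is a nonzero multinomial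
  coefficient. Here intersection theory is replaced by counting dimensions. Let \<open>S\<^sub>d\<close> be the space of
  forms of multidegree \<open>(d, \<dots>, d)\<close>; it is spanned by the products of \<open>d\<close> of the monomials \<open>segre c\<close>
  of multidegree \<open>(1, \<dots>, 1)\<close>. If \<open>f\<^sub>1, \<dots>, f\<^sub>m\<close> of multidegree \<open>(1, \<dots>, 1)\<close> with \<open>m \<le> n\<close> had no common zero, the
  Nullstellensatz on each affine chart would put a power of each monomial \<open>segre c\<close> into the ideal
  generated by the \<open>f\<^sub>l\<close> (\<open>segre_power_mem_combs\<close>), and by the pigeonhole principle all of \<open>S\<^sub>d\<close> for
  large \<open>d\<close>. Iterating, \<open>S\<close> is spanned by the monomials in the \<open>f\<^sub>l\<close> times
  forms of bounded degree, so \<open>dim S\<^sub>d\<close> grows at most like \<open>d ^ (m - 1)\<close> (\<open>growth_bound\<close>). But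
  interpolation on grids shows that it grows at least like \<open>d ^ n\<close> (\<open>many_independent_forms\<close>).

  Polynomials are represented by the functions that they define on complex vectors, with pointwise
  ring operations.
\<close>

section \<open>Linear algebra in rings of complex functions\<close>

definition scl :: "complex \<Rightarrow> ('x \<Rightarrow> complex) \<Rightarrow> 'x \<Rightarrow> complex" where
  "scl c f = (\<lambda>x. c * f x)"

lemma scl_apply: "scl c f x = c * f x"
  by (simp add: scl_def)

text \<open>
  Functions are treated as elements of a ring. They are evaluated at points only on demand, with
  the rules \<open>pointwise\<close>.
\<close>

declare plus_fun_apply [simp del] times_fun_apply [simp del] zero_fun_apply [simp del]
  one_fun_apply [simp del] minus_apply [simp del]

lemma sum_fun_apply: "(\<Sum>i\<in>I. f i) x = (\<Sum>i\<in>I. f i x)"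
  for f :: "'i \<Rightarrow> 'x \<Rightarrow> 'a::comm_monoid_add"
  by (induction I rule: infinite_finite_induct) (auto simp: plus_fun_apply zero_fun_apply)

lemma prod_fun_apply: "(\<Prod>i\<in>I. f i) x = (\<Prod>i\<in>I. f i x)"
  for f :: "'i \<Rightarrow> 'x \<Rightarrow> 'a::comm_monoid_mult"
  by (induction I rule: infinite_finite_induct) (auto simp: times_fun_apply one_fun_apply)

lemma power_fun_apply: "(f ^ n) x = f x ^ n" for f :: "'x \<Rightarrow> complex"
  by (induction n) (auto simp: times_fun_apply one_fun_apply)

lemmas pointwise = plus_fun_apply times_fun_apply zero_fun_apply one_fun_apply scl_apply
  minus_apply sum_fun_apply prod_fun_apply power_fun_apply

interpretation fun_space: vector_space scl
  by unfold_locales (auto simp: fun_eq_iff pointwise algebra_simps)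

lemma scl_eq_mult: "scl c f = scl c 1 * f"
  by (simp add: fun_eq_iff pointwise)

lemma mult_scl: "g * scl c f = scl c (g * f)" "scl c f * g = scl c (f * g)"
  by (simp_all add: fun_eq_iff pointwise)

lemma mult_mem_span:
  assumes "f \<in> fun_space.span U" "\<And>u. u \<in> U \<Longrightarrow> g * u \<in> fun_space.span W"
  shows "g * f \<in> fun_space.span W"
  using assms(1)
proof (induction rule: fun_space.span_induct_alt)
  case base
  show ?case by (simp add: fun_space.span_zero)
next
  case (step c x y)
  then show ?case using assms(2)
    by (simp add: distrib_left mult_scl fun_space.span_add fun_space.span_scale)
qed

lemma mult_mem_span2:
  assumes "f \<in> fun_space.span U" "g \<in> fun_space.span W"
    and "\<And>u w. u \<in> U \<Longrightarrow> w \<in> W \<Longrightarrow> u * w \<in> fun_space.span Z"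
  shows "f * g \<in> fun_space.span Z"
proof (rule mult_mem_span[OF assms(2)])
  fix w assume "w \<in> W"
  show "f * w \<in> fun_space.span Z"
    using mult_mem_span[OF assms(1), of w Z] assms(3) \<open>w \<in> W\<close> by (simp add: mult.commute)
qed

text \<open>
  The relation is indexed by \<open>S\<close>, not by the set of the \<open>q c\<close>, because \<open>q\<close> may take a value twice; in that
  case this value minus itself is the relation.
\<close>

lemma linear_relation_of_card_gt:
  assumes "finite S" "finite T" "card S > card T" "\<And>c. c \<in> S \<Longrightarrow> q c \<in> fun_space.span T"
  obtains a where "\<exists>c\<in>S. a c \<noteq> 0" "(\<Sum>c\<in>S. scl (a c) (q c)) = 0"
proof (cases "inj_on q S")
  case True
  have "fun_space.dependent (q ` S)"
    using fun_space.independent_span_bound[OF \<open>finite T\<close>, of "q ` S"] assms True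
    by (auto simp: card_image)
  then obtain u where u: "\<exists>v\<in>q ` S. u v \<noteq> 0" "(\<Sum>v\<in>q ` S. scl (u v) v) = 0"
    using fun_space.dependent_finite[of "q ` S"] assms(1) by auto
  show ?thesis
    by (rule that[of "u \<circ> q"]) (use u True in \<open>auto simp: sum.reindex\<close>)
next
  case False
  then obtain c d where cd: "c \<in> S" "d \<in> S" "c \<noteq> d" "q c = q d"
    by (auto simp: inj_on_def)
  define a where "a = (\<lambda>e. if e = c then 1 else if e = d then -1 else 0 :: complex)"
  have "(\<Sum>e\<in>S. scl (a e) (q e)) = (\<Sum>e\<in>{c, d}. scl (a e) (q e))"
    using assms(1) cd by (intro sum.mono_neutral_right) (auto simp: a_def fun_eq_iff pointwise)
  also have "\<dots> = 0"
    using cd by (simp add: a_def fun_eq_iff pointwise)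
  finally show ?thesis
    using cd(1) by (intro that[of a]) (auto simp: a_def)
qed

section \<open>Forms and polynomials in given functions\<close>

fun products :: "('x \<Rightarrow> complex) set \<Rightarrow> nat \<Rightarrow> ('x \<Rightarrow> complex) set" where
  "products E 0 = {1}"
| "products E (Suc d) = (\<lambda>(e, m). e * m) ` (E \<times> products E d)"

text \<open>
  For the monomials of multidegree \<open>(1, \<dots>, 1)\<close> in several blocks of variables, these are the forms
  of multidegree \<open>(d, \<dots>, d)\<close>; for a set of coordinates together with the constant \<open>1\<close>, they are the
  polynomials of degree at most \<open>d\<close>.
\<close>

definition forms :: "('x \<Rightarrow> complex) set \<Rightarrow> nat \<Rightarrow> ('x \<Rightarrow> complex) set" where
  "forms E d = fun_space.span (products E d)"

lemma finite_products: "finite E \<Longrightarrow> finite (products E d)"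
  by (induction d) auto

lemma products_mult:
  "f \<in> products E c \<Longrightarrow> g \<in> products E d \<Longrightarrow> f * g \<in> products E (c + d)"
proof (induction c arbitrary: f)
  case (Suc c)
  then obtain e m where "f = e * m" "e \<in> E" "m \<in> products E c"
    by auto
  moreover have "m * g \<in> products E (c + d)"
    using Suc calculation by blast
  ultimately show ?case
    by (auto simp: mult.assoc)
qed auto

lemma one_mem_forms: "1 \<in> forms E 0"
  by (simp add: forms_def fun_space.span_base)

lemma forms_mult:
  "f \<in> forms E c \<Longrightarrow> g \<in> forms E d \<Longrightarrow> f * g \<in> forms E (c + d)"
  unfolding forms_def
  by (rule mult_mem_span2) (auto intro!: fun_space.span_base products_mult)

lemma products_subset_forms: "products E d \<subseteq> forms E d"
  unfolding forms_def by (rule fun_space.span_superset)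

lemma generator_mem_forms: "e \<in> E \<Longrightarrow> e \<in> forms E 1"
  using products_subset_forms[of E 1] by force

lemma forms_add: "f \<in> forms E d \<Longrightarrow> g \<in> forms E d \<Longrightarrow> f + g \<in> forms E d"
  and forms_diff: "f \<in> forms E d \<Longrightarrow> g \<in> forms E d \<Longrightarrow> f - g \<in> forms E d"
  and forms_zero: "0 \<in> forms E d"
  and forms_scl: "f \<in> forms E d \<Longrightarrow> scl c f \<in> forms E d"
  and forms_sum: "(\<And>i. i \<in> I \<Longrightarrow> h i \<in> forms E d) \<Longrightarrow> sum h I \<in> forms E d"
  unfolding forms_def
  by (auto intro: fun_space.span_add fun_space.span_diff fun_space.span_zero
      fun_space.span_scale fun_space.span_sum)

lemma forms_prod:
  "finite I \<Longrightarrow> (\<And>i. i \<in> I \<Longrightarrow> h i \<in> forms E 1) \<Longrightarrow> prod h I \<in> forms E (card I)"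
proof (induction rule: finite_induct)
  case (insert i I)
  have "h i * prod h I \<in> forms E (1 + card I)"
    using insert by (intro forms_mult) auto
  then show ?case using insert by simp
qed (simp add: one_mem_forms)

lemma forms_power: "f \<in> forms E 1 \<Longrightarrow> f ^ d \<in> forms E d"
  using forms_prod[of "{..<d}" "\<lambda>_. f" E] by simp

lemma forms_mono:
  assumes "1 \<in> E" "c \<le> d"
  shows "forms E c \<subseteq> forms E d"
proof
  fix f assume "f \<in> forms E c"
  moreover have "1 \<in> forms E (d - c)"
    using forms_power[OF generator_mem_forms[OF assms(1)], of "d - c"] by simp
  ultimately have "f * 1 \<in> forms E (c + (d - c))"
    by (intro forms_mult)
  then show "f \<in> forms E d" using assms by simp
qed

text \<open>
  The algebra generated by \<open>E\<close>. Adding the constant \<open>1\<close> to the generators makes it an increasing union of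
  spaces that have finite dimension if \<open>E\<close> is finite (\<open>forms_mono\<close>).
\<close>

definition polys :: "('x \<Rightarrow> complex) set \<Rightarrow> ('x \<Rightarrow> complex) set" where
  "polys E = (\<Union>d. forms (insert 1 E) d)"

lemma finite_subset_polys:
  assumes "finite I" "\<And>i. i \<in> I \<Longrightarrow> h i \<in> polys E"
  obtains d where "\<And>i. i \<in> I \<Longrightarrow> h i \<in> forms (insert 1 E) d"
proof -
  from assms(2) have "\<forall>i\<in>I. \<exists>d. h i \<in> forms (insert 1 E) d"
    by (auto simp: polys_def)
  then obtain D where D: "\<And>i. i \<in> I \<Longrightarrow> h i \<in> forms (insert 1 E) (D i)"
    by metis
  have "h i \<in> forms (insert 1 E) (\<Sum>i\<in>I. D i)" if "i \<in> I" for i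
    using forms_mono[of "insert 1 E" "D i" "\<Sum>i\<in>I. D i"] D[OF that] assms(1) that
    by (auto intro: member_le_sum)
  then show ?thesis using that by blast
qed

lemma formsI_polys: "f \<in> forms (insert 1 E) d \<Longrightarrow> f \<in> polys E"
  by (auto simp: polys_def)

lemma polysE:
  assumes "f \<in> polys E"
  obtains d where "f \<in> forms (insert 1 E) d"
  using assms by (auto simp: polys_def)

lemma polys_mult: "f \<in> polys E \<Longrightarrow> g \<in> polys E \<Longrightarrow> f * g \<in> polys E"
  by (elim polysE) (rule formsI_polys, rule forms_mult)

lemma polys_scl: "f \<in> polys E \<Longrightarrow> scl c f \<in> polys E"
  by (elim polysE) (rule formsI_polys, rule forms_scl)

lemma polys_one: "1 \<in> polys E"
  by (rule formsI_polys, rule one_mem_forms)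

lemma polys_zero: "0 \<in> polys E"
  by (rule formsI_polys, rule forms_zero)

lemma polys_gen: "e \<in> E \<Longrightarrow> e \<in> polys E"
  by (rule formsI_polys, rule generator_mem_forms) simp

lemma polys_sum:
  assumes "\<And>i. i \<in> I \<Longrightarrow> h i \<in> polys E"
  shows "sum h I \<in> polys E"
proof (cases "finite I")
  case True
  obtain d where d: "\<And>i. i \<in> I \<Longrightarrow> h i \<in> forms (insert 1 E) d"
    by (rule finite_subset_polys[OF True, of h E]) (use assms in auto)
  have "sum h I \<in> forms (insert 1 E) d"
    by (rule forms_sum) (rule d)
  then show ?thesis by (auto simp: polys_def)
qed (simp add: polys_zero)

lemma polys_add: "f \<in> polys E \<Longrightarrow> g \<in> polys E \<Longrightarrow> f + g \<in> polys E"
  using polys_sum[of "{True, False}" "\<lambda>b. if b then f else g"] by simp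

lemma polys_diff: "f \<in> polys E \<Longrightarrow> g \<in> polys E \<Longrightarrow> f - g \<in> polys E"
  using polys_add[of f E "scl (-1) g"] polys_scl[of g E "-1"] by (simp add: fun_space.scale_minus_left)

lemma polys_prod: "(\<And>i. i \<in> I \<Longrightarrow> h i \<in> polys E) \<Longrightarrow> prod h I \<in> polys E"
  by (induction I rule: infinite_finite_induct) (auto intro: polys_mult polys_one)

lemma polys_induct [consumes 1, case_names gen one add scl mult]:
  assumes "f \<in> polys E"
    and gen: "\<And>e. e \<in> E \<Longrightarrow> P e" and one: "P 1"
    and add: "\<And>f g. f \<in> polys E \<Longrightarrow> g \<in> polys E \<Longrightarrow> P f \<Longrightarrow> P g \<Longrightarrow> P (f + g)"
    and scl: "\<And>c f. f \<in> polys E \<Longrightarrow> P f \<Longrightarrow> P (scl c f)"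
    and mult: "\<And>f g. f \<in> polys E \<Longrightarrow> g \<in> polys E \<Longrightarrow> P f \<Longrightarrow> P g \<Longrightarrow> P (f * g)"
  shows "P f"
proof -
  have m: "m \<in> polys E \<and> P m" if "m \<in> products (insert 1 E) d" for m d
    using that
  proof (induction d arbitrary: m)
    case 0
    then show ?case by (simp add: polys_one one)
  next
    case (Suc d)
    then obtain e m' where m': "m = e * m'" "e \<in> insert 1 E" "m' \<in> products (insert 1 E) d"
      by auto
    have "e \<in> polys E \<and> P e" using m'(2) gen one polys_gen polys_one by auto
    then show ?case using Suc.IH[OF m'(3)] m'(1) mult polys_mult by auto
  qed
  obtain d where "f \<in> fun_space.span (products (insert 1 E) d)"
    using assms(1) by (auto simp: polys_def forms_def)
  then have "f \<in> polys E \<and> P f"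
  proof (induction rule: fun_space.span_induct_alt)
    case base
    have "scl 0 1 = (0 :: 'a \<Rightarrow> complex)" by (simp add: fun_eq_iff pointwise)
    then show ?case using scl[OF polys_one one, of 0] polys_zero by auto
  next
    case (step c x y)
    then show ?case using m[OF step(1)] by (blast intro: add scl polys_add polys_scl)
  qed
  then show ?thesis ..
qed

section \<open>The weak Nullstellensatz\<close>

definition ideal_in :: "('x \<Rightarrow> complex) set \<Rightarrow> ('x \<Rightarrow> complex) set \<Rightarrow> bool" where
  "ideal_in R M \<longleftrightarrow> M \<subseteq> R \<and> 0 \<in> M \<and> (\<forall>f\<in>M. \<forall>g\<in>M. f + g \<in> M) \<and> (\<forall>r\<in>R. \<forall>f\<in>M. r * f \<in> M)"

lemma ideal_in_subset: "ideal_in R M \<Longrightarrow> f \<in> M \<Longrightarrow> f \<in> R"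
  and ideal_in_zero: "ideal_in R M \<Longrightarrow> 0 \<in> M"
  and ideal_in_add: "ideal_in R M \<Longrightarrow> f \<in> M \<Longrightarrow> g \<in> M \<Longrightarrow> f + g \<in> M"
  and ideal_in_mult: "ideal_in R M \<Longrightarrow> r \<in> R \<Longrightarrow> f \<in> M \<Longrightarrow> r * f \<in> M"
  by (auto simp: ideal_in_def)

lemma ideal_in_sum:
  assumes "ideal_in R M" "\<And>i. i \<in> I \<Longrightarrow> h i \<in> M"
  shows "sum h I \<in> M"
  using assms(2) by (induction I rule: infinite_finite_induct)
    (auto intro: ideal_in_add[OF assms(1)] ideal_in_zero[OF assms(1)])

lemma ideal_in_scl:
  assumes "ideal_in (polys E) M" "f \<in> M"
  shows "scl c f \<in> M"
  using ideal_in_mult[OF assms(1) polys_scl[OF polys_one] assms(2), of c] scl_eq_mult[of c f] by simp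

lemma ideal_in_diff:
  assumes "ideal_in (polys E) M" "f \<in> M" "g \<in> M"
  shows "f - g \<in> M"
  using ideal_in_add[OF assms(1,2) ideal_in_scl[OF assms(1,3), of "-1"]]
  by (simp add: fun_space.scale_minus_left)

text \<open>
  The last property says that the quotient by \<open>M\<close> is a field: if \<open>g\<close> is not in \<open>M\<close>, the ideal
  generated by \<open>M\<close> and \<open>g\<close> contains \<open>1\<close> by maximality.
\<close>

lemma maximal_ideal_exists:
  assumes I: "ideal_in (polys E) I" "1 \<notin> I"
  obtains M where "ideal_in (polys E) M" "I \<subseteq> M" "1 \<notin> M"
    "\<forall>g\<in>polys E - M. \<exists>q\<in>polys E. 1 - q * g \<in> M"
proof -
  define \<A> where "\<A> = {M. ideal_in (polys E) M \<and> I \<subseteq> M \<and> 1 \<notin> M}"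
  have "\<exists>M\<in>\<A>. \<forall>X\<in>\<A>. M \<subseteq> X \<longrightarrow> X = M"
  proof (rule subset_Zorn_nonempty)
    show "\<A> \<noteq> {}" using I by (auto simp: \<A>_def)
    fix C assume C: "C \<noteq> {}" "subset.chain \<A> C"
    have sub: "\<And>X. X \<in> C \<Longrightarrow> ideal_in (polys E) X \<and> I \<subseteq> X \<and> 1 \<notin> X"
      using C(2) by (auto simp: subset.chain_def \<A>_def)
    have lin: "\<And>X Y. X \<in> C \<Longrightarrow> Y \<in> C \<Longrightarrow> X \<subseteq> Y \<or> Y \<subseteq> X"
      using C(2) by (auto simp: subset_chain_def)
    have "f + g \<in> \<Union>C" if fg: "f \<in> \<Union>C" "g \<in> \<Union>C" for f g
    proof -
      obtain X Y where "X \<in> C" "Y \<in> C" "f \<in> X" "g \<in> Y" using fg by blast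
      then obtain Z where "Z \<in> C" "f \<in> Z" "g \<in> Z" using lin by blast
      then show ?thesis using sub ideal_in_add by blast
    qed
    moreover have "r * f \<in> \<Union>C" if "f \<in> \<Union>C" "r \<in> polys E" for f r
      using that sub ideal_in_mult by blast
    moreover have "\<Union>C \<subseteq> polys E" using sub ideal_in_subset by blast
    moreover have "0 \<in> \<Union>C" using sub C(1) ideal_in_zero by blast
    ultimately have "ideal_in (polys E) (\<Union>C)" by (simp add: ideal_in_def)
    then show "\<Union>C \<in> \<A>" using sub C(1) by (auto simp: \<A>_def)
  qed
  then obtain M where M: "ideal_in (polys E) M" "I \<subseteq> M" "1 \<notin> M"
    and max: "\<And>X. ideal_in (polys E) X \<Longrightarrow> 1 \<notin> X \<Longrightarrow> M \<subseteq> X \<Longrightarrow> X = M"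
    unfolding \<A>_def by auto
  have "\<exists>q\<in>polys E. 1 - q * g \<in> M" if g: "g \<in> polys E" "g \<notin> M" for g
  proof (rule ccontr)
    assume no: "\<not> ?thesis"
    define X where "X = {m + q * g |m q. m \<in> M \<and> q \<in> polys E}"
    have XI: "m + q * g \<in> X" if "m \<in> M" "q \<in> polys E" for m q
      using that by (auto simp: X_def)
    have "ideal_in (polys E) X"
      unfolding ideal_in_def
    proof (intro conjI ballI subsetI)
      show "f \<in> polys E" if "f \<in> X" for f
        using that g(1) ideal_in_subset[OF M(1)] by (auto simp: X_def intro: polys_add polys_mult)
      show "0 \<in> X" using XI[OF ideal_in_zero[OF M(1)] polys_zero] by simp
      show "f1 + f2 \<in> X" if "f1 \<in> X" "f2 \<in> X" for f1 f2
      proof -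
        obtain m1 q1 m2 q2 where *: "f1 = m1 + q1 * g" "f2 = m2 + q2 * g" "m1 \<in> M" "m2 \<in> M"
          "q1 \<in> polys E" "q2 \<in> polys E"
          using \<open>f1 \<in> X\<close> \<open>f2 \<in> X\<close> by (auto simp: X_def)
        have "f1 + f2 = (m1 + m2) + (q1 + q2) * g" by (simp add: * algebra_simps)
        then show ?thesis using XI[OF ideal_in_add[OF M(1) *(3,4)] polys_add[OF *(5,6)]] by metis
      qed
      show "r * f \<in> X" if "r \<in> polys E" "f \<in> X" for r f
      proof -
        obtain m q where *: "f = m + q * g" "m \<in> M" "q \<in> polys E"
          using \<open>f \<in> X\<close> by (auto simp: X_def)
        have "r * f = r * m + (r * q) * g" by (simp add: * algebra_simps)
        then show ?thesis using XI[OF ideal_in_mult[OF M(1) that(1) *(2)] polys_mult[OF that(1) *(3)]] by metis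
      qed
    qed
    moreover have "1 \<notin> X"
    proof
      assume "1 \<in> X"
      then obtain m q where "1 = m + q * g" "m \<in> M" "q \<in> polys E" by (auto simp: X_def)
      then show False using no by (metis add_diff_cancel_right')
    qed
    moreover have "M \<subseteq> X" using XI[OF _ polys_zero] by auto
    ultimately have "X = M" by (rule max)
    then show False using XI[OF ideal_in_zero[OF M(1)] polys_one] g(2) by simp
  qed
  then have "\<forall>g\<in>polys E - M. \<exists>q\<in>polys E. 1 - q * g \<in> M" by blast
  with M show thesis by (rule that)
qed

lemma poly_comp_mem_polys:
  assumes "e \<in> polys E"
  shows "(\<lambda>x. poly P (e x)) \<in> polys E"
proof (induction P)
  case 0
  have "(\<lambda>x. poly 0 (e x)) = 0" by (simp add: fun_eq_iff pointwise)
  then show ?case by (simp add: polys_zero)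
next
  case (pCons a P)
  have "(\<lambda>x. poly (pCons a P) (e x)) = scl a 1 + e * (\<lambda>x. poly P (e x))"
    by (simp add: fun_eq_iff pointwise)
  then show ?case using pCons assms by (auto intro: polys_add polys_scl polys_one polys_mult)
qed

text \<open>
  Over the complex numbers \<open>P\<close> splits into linear factors, and a product of units modulo \<open>M\<close> is a unit.
\<close>

lemma poly_comp_unit:
  assumes M: "ideal_in (polys E) M" and e: "e \<in> polys E"
    and inv: "\<And>c. \<exists>q\<in>polys E. 1 - q * (e - scl c 1) \<in> M"
    and "P \<noteq> 0"
  shows "\<exists>q\<in>polys E. 1 - q * (\<lambda>x. poly P (e x)) \<in> M"
  using \<open>P \<noteq> 0\<close>
proof (induction "degree P" arbitrary: P)
  case 0
  then obtain a where a: "P = [:a:]" "a \<noteq> 0" by (metis degree_eq_zeroE pCons_0_0)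
  have "1 - scl (1/a) 1 * (\<lambda>x. poly P (e x)) = 0"
    using a by (simp add: fun_eq_iff pointwise)
  then show ?case using ideal_in_zero[OF M] polys_scl[OF polys_one] by metis
next
  case (Suc d)
  have "\<not> constant (poly P)" using Suc(2) by (simp add: constant_degree)
  then obtain c where "poly P c = 0" using fundamental_theorem_of_algebra by blast
  then obtain Q where Q: "P = [:-c, 1:] * Q" by (metis dvdE poly_eq_0_iff_dvd)
  have "Q \<noteq> 0" using Q Suc(3) by auto
  moreover have "d = degree Q" using Suc(2) \<open>Q \<noteq> 0\<close> by (simp add: Q degree_mult_eq del: mult_pCons_left)
  ultimately obtain q where q: "q \<in> polys E" "1 - q * (\<lambda>x. poly Q (e x)) \<in> M"
    using Suc(1) by blast
  obtain r where r: "r \<in> polys E" "1 - r * (e - scl c 1) \<in> M" using inv by blast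
  have P: "(\<lambda>x. poly P (e x)) = (e - scl c 1) * (\<lambda>x. poly Q (e x))"
    by (simp add: Q fun_eq_iff pointwise algebra_simps)
  have "1 - (q * r) * (\<lambda>x. poly P (e x))
      = (1 - q * (\<lambda>x. poly Q (e x))) + (q * (\<lambda>x. poly Q (e x))) * (1 - r * (e - scl c 1))"
    unfolding P by (simp add: algebra_simps)
  also have "\<dots> \<in> M"
    by (intro ideal_in_add[OF M] ideal_in_mult[OF M] q r polys_mult poly_comp_mem_polys e)
  finally show ?case using polys_mult[OF q(1) r(1)] by blast
qed

text \<open>
  The quotient by \<open>M\<close> is a field of countable dimension over the uncountable field of complex numbers. If
  \<open>e\<close> were congruent to no scalar, all \<open>e - c\<close> would have inverses modulo \<open>M\<close>, too many to be linearly
  independent. Clearing denominators in a linear relation between these inverses gives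
  a nonzero polynomial that maps \<open>e\<close> into \<open>M\<close>, in contradiction to \<open>poly_comp_unit\<close>.
\<close>

lemma residue_is_scalar:
  assumes fin: "finite E" and M: "ideal_in (polys E) M" "1 \<notin> M"
    and max: "\<forall>g\<in>polys E - M. \<exists>q\<in>polys E. 1 - q * g \<in> M"
    and e: "e \<in> polys E"
  shows "\<exists>c. e - scl c 1 \<in> M"
proof (rule ccontr)
  assume no: "\<not> ?thesis"
  have lin: "e - scl c 1 \<in> polys E" for c
    by (intro polys_diff polys_scl polys_one e)
  have inv: "\<exists>q\<in>polys E. 1 - q * (e - scl c 1) \<in> M" for c
    using max lin[of c] no by blast
  then obtain q where q: "\<And>c. q c \<in> polys E" "\<And>c. 1 - q c * (e - scl c 1) \<in> M"
    by metis
  define U where "U d = {c. q c \<in> forms (insert 1 E) d}" for d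
  have U: "(\<Union>d. U d) = (UNIV :: complex set)"
    using q(1) by (auto simp: polys_def U_def)
  have "\<exists>d. infinite (U d)"
  proof (rule ccontr)
    assume "\<not> ?thesis"
    then have "countable (\<Union>d. U d)"
      by (intro countable_UN) (auto intro: countable_finite)
    then show False using uncountable_UNIV_complex unfolding U by blast
  qed
  then obtain d where "infinite {c. q c \<in> forms (insert 1 E) d}"
    unfolding U_def by (rule exE)
  then obtain S where S: "S \<subseteq> {c. q c \<in> forms (insert 1 E) d}" "finite S"
    "card S = Suc (card (products (insert 1 E) d))"
    using infinite_arbitrarily_large by blast
  obtain a where a: "\<exists>c\<in>S. a c \<noteq> 0" "(\<Sum>c\<in>S. scl (a c) (q c)) = 0"
    by (rule linear_relation_of_card_gt[OF S(2) finite_products, of "insert 1 E" d q])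
      (use S fin in \<open>auto simp: forms_def\<close>)
  obtain c0 where c0: "c0 \<in> S" "a c0 \<noteq> 0" using a(1) by blast
  \<comment> \<open>The numerator of \<open>\<Sum>c\<in>S. a c / (X - c)\<close>; at \<open>c0\<close> only one of its summands survives.\<close>
  define P where "P = (\<Sum>c\<in>S. smult (a c) (\<Prod>b\<in>S - {c}. [:-b, 1:]))"
  have "poly P c0 = (\<Sum>c\<in>{c0}. a c * (\<Prod>b\<in>S - {c}. c0 - b))"
    unfolding P_def poly_sum poly_smult poly_prod
    by (rule sum.mono_neutral_cong_right) (use S(2) c0 in auto)
  also have "\<dots> \<noteq> 0" using c0 S(2) by auto
  finally have "P \<noteq> 0" by auto
  define Q where "Q = (\<Prod>b\<in>S. e - scl b 1)"
  define T where "T = (\<lambda>c. \<Prod>b\<in>S - {c}. e - scl b 1)"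
  have T: "T c \<in> polys E" for c
    unfolding T_def by (intro polys_prod lin)
  have QT: "Q = T c * (e - scl c 1)" if "c \<in> S" for c
    unfolding Q_def T_def using prod.remove[OF S(2) that, of "\<lambda>b. e - scl b 1"] by (simp add: mult.commute)
  have "(\<lambda>x. poly P (e x)) = (\<Sum>c\<in>S. scl (a c) (T c))"
    by (simp add: P_def T_def fun_eq_iff pointwise poly_sum poly_prod)
  \<comment> \<open>Up to an element of \<open>M\<close>, the product \<open>Q * q c\<close> is \<open>T c\<close>, as \<open>q c\<close> inverts \<open>e - c\<close>.\<close>
  also have "\<dots> = (\<Sum>c\<in>S. scl (a c) (T c)) - Q * (\<Sum>c\<in>S. scl (a c) (q c))"
    by (simp add: a(2))
  also have "\<dots> = (\<Sum>c\<in>S. scl (a c) (T c) - Q * scl (a c) (q c))"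
    by (simp add: sum_distrib_left sum_subtractf)
  also have "\<dots> = (\<Sum>c\<in>S. scl (a c) (T c * (1 - q c * (e - scl c 1))))"
    by (rule sum.cong[OF refl], simp add: QT fun_eq_iff pointwise algebra_simps)
  also have "\<dots> \<in> M"
    by (intro ideal_in_sum[OF M(1)] ideal_in_scl[OF M(1)] ideal_in_mult[OF M(1)] T q(2))
  finally have PM: "(\<lambda>x. poly P (e x)) \<in> M" .
  obtain r where r: "r \<in> polys E" "1 - r * (\<lambda>x. poly P (e x)) \<in> M"
    using poly_comp_unit[OF M(1) e inv \<open>P \<noteq> 0\<close>] by blast
  have "1 = (1 - r * (\<lambda>x. poly P (e x))) + r * (\<lambda>x. poly P (e x))" by simp
  also have "\<dots> \<in> M" by (intro ideal_in_add[OF M(1)] ideal_in_mult[OF M(1)] r PM)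
  finally show False using M(2) by blast
qed

definition coords :: "'v set \<Rightarrow> (('v \<Rightarrow> complex) \<Rightarrow> complex) set" where
  "coords V = (\<lambda>v z. z v) ` V"

text \<open>
  If the ideal generated by the \<open>F l\<close> is proper, it is contained in a maximal ideal \<open>M\<close>. By
  \<open>residue_is_scalar\<close> each coordinate is congruent to a scalar modulo \<open>M\<close>. These scalars are the
  coordinates of a point \<open>z\<close> such that every polynomial is congruent to its value at \<open>z\<close>. So all
  elements of \<open>M\<close>, in particular all \<open>F l\<close>, vanish at \<open>z\<close>.
\<close>

theorem weak_nullstellensatz:
  assumes "finite V" "finite L" and F: "\<And>l. l \<in> L \<Longrightarrow> F l \<in> polys (coords V)" 
    and no_zero: "\<And>z. \<exists>l\<in>L. F l z \<noteq> 0"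
  shows "\<exists>h. (\<forall>l\<in>L. h l \<in> polys (coords V)) \<and> (\<Sum>l\<in>L. h l * F l) = 1"
proof (rule ccontr)
  assume no: "\<not> ?thesis"
  let ?R = "polys (coords V)"
  define I where "I = {(\<Sum>l\<in>L. h l * F l) |h. \<forall>l\<in>L. h l \<in> ?R}"
  have II: "(\<Sum>l\<in>L. h l * F l) \<in> I" if "\<And>l. l \<in> L \<Longrightarrow> h l \<in> ?R" for h
    using that by (auto simp: I_def)
  have "ideal_in ?R I"
    unfolding ideal_in_def
  proof (intro conjI ballI subsetI)
    show "f \<in> ?R" if "f \<in> I" for f
      using that F by (auto simp: I_def intro!: polys_sum polys_mult)
    show "0 \<in> I" using II[of "\<lambda>_. 0"] polys_zero by auto
    show "f + g \<in> I" if fg: "f \<in> I" "g \<in> I" for f g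
    proof -
      obtain h k where *: "f = (\<Sum>l\<in>L. h l * F l)" "g = (\<Sum>l\<in>L. k l * F l)"
        "\<And>l. l \<in> L \<Longrightarrow> h l \<in> ?R" "\<And>l. l \<in> L \<Longrightarrow> k l \<in> ?R"
        using fg by (auto simp: I_def)
      have "f + g = (\<Sum>l\<in>L. (h l + k l) * F l)" by (simp add: * sum.distrib distrib_right)
      also have "\<dots> \<in> I" by (intro II polys_add *)
      finally show ?thesis .
    qed
    show "r * f \<in> I" if rf: "r \<in> ?R" "f \<in> I" for r f
    proof -
      obtain h where *: "f = (\<Sum>l\<in>L. h l * F l)" "\<And>l. l \<in> L \<Longrightarrow> h l \<in> ?R"
        using rf by (auto simp: I_def)
      have "r * f = (\<Sum>l\<in>L. (r * h l) * F l)" by (simp add: * sum_distrib_left mult.assoc)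
      also have "\<dots> \<in> I" by (intro II polys_mult * rf)
      finally show ?thesis .
    qed
  qed
  moreover have "1 \<notin> I"
  proof
    assume "1 \<in> I"
    then obtain h where "1 = (\<Sum>l\<in>L. h l * F l)" "\<forall>l\<in>L. h l \<in> ?R"
      by (auto simp: I_def)
    then show False using no by metis
  qed
  ultimately obtain M where M: "ideal_in ?R M" "I \<subseteq> M" "1 \<notin> M"
    "\<forall>g\<in>?R - M. \<exists>q\<in>?R. 1 - q * g \<in> M"
    by (rule maximal_ideal_exists)
  have fin: "finite (coords V)" using \<open>finite V\<close> by (simp add: coords_def)
  have "\<exists>c. (\<lambda>z. z v) - scl c 1 \<in> M" if "v \<in> V" for v
    by (rule residue_is_scalar[OF fin M(1,3,4)])
      (use that in \<open>auto simp: coords_def intro: polys_gen\<close>)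
  then obtain z where z: "\<And>v. v \<in> V \<Longrightarrow> (\<lambda>z. z v) - scl (z v) 1 \<in> M" by metis
  have ev: "f - scl (f z) 1 \<in> M" if "f \<in> ?R" for f
    using that
  proof (induction rule: polys_induct)
    case (gen e)
    then show ?case using z by (auto simp: coords_def)
  next
    case one
    have "1 - scl (1 z) 1 = (0 :: ('a \<Rightarrow> complex) \<Rightarrow> complex)" by (simp add: fun_eq_iff pointwise)
    then show ?case using ideal_in_zero[OF M(1)] by simp
  next
    case (add f g)
    have "f + g - scl ((f + g) z) 1 = (f - scl (f z) 1) + (g - scl (g z) 1)"
      by (simp add: fun_eq_iff pointwise algebra_simps)
    then show ?case using ideal_in_add[OF M(1) add(3,4)] by (simp only:)
  next
    case (scl c f)
    have "scl c f - scl (scl c f z) 1 = scl c (f - scl (f z) 1)"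
      by (simp add: fun_eq_iff pointwise algebra_simps)
    then show ?case using ideal_in_scl[OF M(1) scl(2)] by (simp only:)
  next
    case (mult f g)
    have "f * g - scl ((f * g) z) 1 = g * (f - scl (f z) 1) + scl (f z) (g - scl (g z) 1)"
      by (simp add: fun_eq_iff pointwise algebra_simps)
    also have "\<dots> \<in> M"
      by (intro ideal_in_add[OF M(1)] ideal_in_mult[OF M(1)] ideal_in_scl[OF M(1)] mult)
    finally show ?case .
  qed
  obtain l where l: "l \<in> L" "F l z \<noteq> 0" using no_zero by blast
  have "F l = (\<Sum>k\<in>L. (if k = l then 1 else 0) * F k)"
    using \<open>finite L\<close> l(1) by (simp add: if_distrib[of "\<lambda>u. u * _"] cong: if_cong)
  also have "\<dots> \<in> I" by (intro II) (auto intro: polys_one polys_zero)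
  finally have "F l \<in> M" using M(2) by blast
  have "scl (F l z) 1 = F l - (F l - scl (F l z) 1)"
    by (simp add: fun_eq_iff pointwise)
  also have "\<dots> \<in> M"
    by (rule ideal_in_diff[OF M(1) \<open>F l \<in> M\<close> ev[OF F[OF l(1)]]])
  finally have "scl (1 / F l z) (scl (F l z) 1) \<in> M"
    by (rule ideal_in_scl[OF M(1)])
  moreover have "scl (1 / F l z) (scl (F l z) 1) = 1"
    using l(2) by (simp add: fun_eq_iff pointwise)
  ultimately show False using M(3) by metis
qed

section \<open>Growth of a graded algebra over few forms\<close>

lemma products_insert:
  assumes "f \<in> products (insert e E) M"
  obtains a m where "a \<le> M" "m \<in> products E (M - a)" "f = e ^ a * m"
proof -
  have "\<exists>a\<le>M. \<exists>m\<in>products E (M - a). f = e ^ a * m"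
    using assms
  proof (induction M arbitrary: f)
    case (Suc M)
    then obtain e' g where g: "f = e' * g" "e' \<in> insert e E" "g \<in> products (insert e E) M"
      by auto
    then obtain a m where am: "a \<le> M" "m \<in> products E (M - a)" "g = e ^ a * m"
      using Suc.IH by blast
    show ?case
    proof (cases "e' = e")
      case True
      then have "f = e ^ Suc a * m" using g am by (simp add: mult.assoc)
      moreover have "m \<in> products E (Suc M - Suc a)" using am by simp
      ultimately show ?thesis using am(1) Suc_le_mono by blast
    next
      case False
      then have "e' * m \<in> products E (Suc M - a)"
        using am g by (auto simp: Suc_diff_le)
      moreover have "f = e ^ a * (e' * m)" using g am by (simp add: mult_ac)
      ultimately show ?thesis using am(1) le_SucI by blast
    qed
  qed auto
  then show thesis using that by blast
qed

text \<open>
  The exponent is the point: a monomial of degree \<open>t\<close> is determined by the exponents of all but one of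
  its variables.
\<close>

lemma card_products:
  assumes "finite E" "E \<noteq> {}"
  shows "card (products E t) \<le> (t + 1) ^ (card E - 1)"
  using assms
proof (induction E arbitrary: t rule: finite_ne_induct)
  case (singleton e)
  have "products {e} t \<subseteq> {e ^ t}"
    by (induction t) auto
  then show ?case using card_mono[of "{e ^ t}"] by auto
next
  case (insert e F)
  have "products (insert e F) t \<subseteq> (\<Union>a\<in>{..t}. (\<lambda>m. e ^ a * m) ` products F (t - a))"
    by (auto elim!: products_insert)
  then have "card (products (insert e F) t) \<le> card (\<Union>a\<in>{..t}. (\<lambda>m. e ^ a * m) ` products F (t - a))"
    using insert by (intro card_mono) (auto intro: finite_products)
  also have "\<dots> \<le> (\<Sum>a\<le>t. card ((\<lambda>m. e ^ a * m) ` products F (t - a)))"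
    by (rule card_UN_le) simp
  also have "\<dots> \<le> (\<Sum>a\<le>t. (t + 1) ^ (card F - 1))"
  proof (rule sum_mono)
    fix a assume "a \<in> {..t}"
    have "card ((\<lambda>m. e ^ a * m) ` products F (t - a)) \<le> card (products F (t - a))"
      using insert by (intro card_image_le finite_products)
    also have "\<dots> \<le> (t - a + 1) ^ (card F - 1)" by (rule insert.IH)
    also have "\<dots> \<le> (t + 1) ^ (card F - 1)" by (intro power_mono) auto
    finally show "card ((\<lambda>m. e ^ a * m) ` products F (t - a)) \<le> (t + 1) ^ (card F - 1)" .
  qed
  also have "\<dots> = (t + 1) ^ Suc (card F - 1)" by simp
  also have "Suc (card F - 1) = card (insert e F) - 1"
    using insert by (simp add: card_gt_0_iff)
  finally show ?case .
qed

text \<open>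
  If the \<open>f l\<close> are forms of degree 1, these are the elements of degree \<open>d + 1\<close> of the ideal that they
  generate.
\<close>

definition combs :: "('x \<Rightarrow> complex) set \<Rightarrow> 'l set \<Rightarrow> ('l \<Rightarrow> 'x \<Rightarrow> complex) \<Rightarrow> nat \<Rightarrow> ('x \<Rightarrow> complex) set" where
  "combs E L f d = {(\<Sum>l\<in>L. h l * f l) |h. \<forall>l\<in>L. h l \<in> forms E d}"

lemma combsI: "(\<And>l. l \<in> L \<Longrightarrow> h l \<in> forms E d) \<Longrightarrow> (\<Sum>l\<in>L. h l * f l) \<in> combs E L f d"
  by (auto simp: combs_def)

lemma combsE:
  assumes "g \<in> combs E L f d"
  obtains h where "\<forall>l\<in>L. h l \<in> forms E d" "g = (\<Sum>l\<in>L. h l * f l)"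
  using assms by (auto simp: combs_def)

lemma combs_mult:
  assumes "g \<in> forms E c" "x \<in> combs E L f d"
  shows "g * x \<in> combs E L f (c + d)"
proof -
  obtain h where h: "\<forall>l\<in>L. h l \<in> forms E d" "x = (\<Sum>l\<in>L. h l * f l)"
    using assms(2) by (rule combsE)
  have "g * x = (\<Sum>l\<in>L. (g * h l) * f l)" by (simp add: h(2) sum_distrib_left mult.assoc)
  also have "\<dots> \<in> combs E L f (c + d)" by (intro combsI forms_mult assms h(1)[rule_format])
  finally show ?thesis .
qed

lemma subspace_combs: "fun_space.subspace (combs E L f d)"
proof (rule fun_space.subspaceI)
  show "0 \<in> combs E L f d" using combsI[of L "\<lambda>_. 0" E d f] by (simp add: forms_zero)
next
  fix x y assume xy: "x \<in> combs E L f d" "y \<in> combs E L f d"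
  obtain h where h: "\<forall>l\<in>L. h l \<in> forms E d" "x = (\<Sum>l\<in>L. h l * f l)"
    using xy(1) by (rule combsE)
  obtain k where k: "\<forall>l\<in>L. k l \<in> forms E d" "y = (\<Sum>l\<in>L. k l * f l)"
    using xy(2) by (rule combsE)
  have "x + y = (\<Sum>l\<in>L. (h l + k l) * f l)" by (simp add: h k sum.distrib distrib_right)
  also have "\<dots> \<in> combs E L f d" by (intro combsI forms_add h(1)[rule_format] k(1)[rule_format])
  finally show "x + y \<in> combs E L f d" .
next
  fix c x assume "x \<in> combs E L f d"
  moreover have "scl c 1 \<in> forms E 0" by (intro forms_scl one_mem_forms)
  ultimately have "scl c 1 * x \<in> combs E L f (0 + d)" by (intro combs_mult)
  then show "scl c x \<in> combs E L f d" using scl_eq_mult[of c x] by simp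
qed

text \<open>
  The pigeonhole principle: a long product of the finitely many elements of \<open>E'\<close> contains one of them with a
  high power, and this power lies in the ideal.
\<close>

lemma products_subset_combs:
  assumes "finite E'" "E' \<subseteq> E" "\<And>e. e \<in> E' \<Longrightarrow> \<exists>d. e ^ Suc d \<in> combs E L f d"
  shows "\<exists>N. \<forall>M\<ge>N. products E' (Suc M) \<subseteq> combs E L f M"
  using assms
proof (induction E' rule: finite_induct)
  case empty
  show ?case by simp
next
  case (insert e E')
  obtain N where N: "\<And>M. M \<ge> N \<Longrightarrow> products E' (Suc M) \<subseteq> combs E L f M"
    using insert.IH insert.prems by (meson insert_subset insertI2)
  obtain d where d: "e ^ Suc d \<in> combs E L f d" using insert.prems(2) by blast
  have pow: "e ^ a \<in> forms E a" for a
    using insert by (intro forms_power generator_mem_forms) auto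
  have sub: "products E' k \<subseteq> forms E k" for k
  proof (induction k)
    case (Suc k)
    have "x * m \<in> forms E (1 + k)" if "x \<in> E'" "m \<in> products E' k" for x m
      using that Suc insert.prems(1) by (intro forms_mult generator_mem_forms) auto
    then show ?case by auto
  qed (simp add: one_mem_forms)
  have "x \<in> combs E L f M" if M: "M \<ge> N + d" and x: "x \<in> products (insert e E') (Suc M)" for M x
  proof -
    obtain a m where am: "a \<le> Suc M" "m \<in> products E' (Suc M - a)" "x = e ^ a * m"
      using x by (rule products_insert)
    show ?thesis
    proof (cases "a \<ge> Suc d")
      case True
      then have "x = (e ^ (a - Suc d) * m) * e ^ Suc d"
        by (simp only: am(3) mult_ac flip: power_add) simp
      moreover have "e ^ (a - Suc d) * m \<in> forms E (a - Suc d + (Suc M - a))"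
        using am sub by (intro forms_mult pow) auto
      ultimately have "x \<in> combs E L f (a - Suc d + (Suc M - a) + d)"
        using combs_mult d by blast
      moreover have "a - Suc d + (Suc M - a) + d = M" using True am(1) by simp
      ultimately show ?thesis by simp
    next
      case False
      then have "Suc M - a = Suc (M - a)" "M - a \<ge> N" using M by auto
      then have "m \<in> combs E L f (M - a)" using N am(2) by auto
      then have "x \<in> combs E L f (a + (M - a))"
        unfolding am(3) by (intro combs_mult pow)
      then show ?thesis using False M by simp
    qed
  qed
  then show ?case by blast
qed

text \<open>
  In high degree every form is \<open>\<Sum>l\<in>L. h l * f l\<close> with coefficients of degree one less. Repeating this
  for the coefficients \<open>t\<close> times writes a form of degree \<open>N + t\<close> by monomials of degree \<open>t\<close> in the \<open>f l\<close>
  and products of degree \<open>N\<close>. The number of the latter does not depend on \<open>t\<close>, and the former are counted by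
  \<open>card_products\<close>.
\<close>

theorem growth_bound:
  assumes "finite E" "finite L" "L \<noteq> {}"
    and nil: "\<And>e. e \<in> E \<Longrightarrow> \<exists>d. e ^ Suc d \<in> combs E L f d"
  shows "\<exists>N B. \<forall>t S. fun_space.independent S \<longrightarrow> S \<subseteq> forms E (N + t) \<longrightarrow>
           card S \<le> B * (t + 1) ^ (card L - 1)"
proof -
  obtain N where N: "\<And>M. M \<ge> N \<Longrightarrow> products E (Suc M) \<subseteq> combs E L f M"
    using products_subset_combs[OF assms(1) subset_refl nil] by blast
  have step: "forms E (Suc M) \<subseteq> combs E L f M" if "M \<ge> N" for M
    unfolding forms_def by (intro fun_space.span_minimal N that subspace_combs)
  define W where "W t = (\<lambda>(a, b). a * b) ` (products (f ` L) t \<times> products E N)" for t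
  have W: "forms E (N + t) \<subseteq> fun_space.span (W t)" for t
  proof (induction t)
    case 0
    have "W 0 = products E N" by (force simp: W_def)
    then show ?case by (simp add: forms_def)
  next
    case (Suc t)
    show ?case
    proof
      fix x assume "x \<in> forms E (N + Suc t)"
      then have "x \<in> combs E L f (N + t)" using step[of "N + t"] by auto
      then obtain h where h: "\<forall>l\<in>L. h l \<in> forms E (N + t)" "x = (\<Sum>l\<in>L. h l * f l)"
        by (rule combsE)
      have "f l * h l \<in> fun_space.span (W (Suc t))" if l: "l \<in> L" for l
      proof (rule mult_mem_span)
        show "h l \<in> fun_space.span (W t)" using h(1) l Suc by blast
        fix w assume "w \<in> W t"
        then obtain a b where "a \<in> products (f ` L) t" "b \<in> products E N" "w = a * b"
          by (auto simp: W_def)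
        then have "f l * w = (f l * a) * b" "f l * a \<in> products (f ` L) (Suc t)" "b \<in> products E N"
          using l by (auto simp: mult.assoc)
        then have "f l * w \<in> W (Suc t)"
          unfolding W_def by (intro image_eqI[of _ _ "(f l * a, b)"]) auto
        then show "f l * w \<in> fun_space.span (W (Suc t))" by (rule fun_space.span_base)
      qed
      then show "x \<in> fun_space.span (W (Suc t))"
        unfolding h(2) by (intro fun_space.span_sum) (simp add: mult.commute)
    qed
  qed
  have fW: "finite (W t)" for t
    unfolding W_def using assms by (intro finite_imageI finite_cartesian_product finite_products) auto
  have "card (W t) \<le> card (products E N) * (t + 1) ^ (card L - 1)" for t
  proof -
    have "card (W t) \<le> card (products (f ` L) t \<times> products E N)"
      unfolding W_def using assms by (intro card_image_le finite_cartesian_product finite_products) auto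
    also have "\<dots> = card (products (f ` L) t) * card (products E N)"
      by (rule card_cartesian_product)
    also have "card (products (f ` L) t) \<le> (t + 1) ^ (card (f ` L) - 1)"
      using assms by (intro card_products) auto
    also have "\<dots> \<le> (t + 1) ^ (card L - 1)"
      using assms by (intro power_increasing diff_le_mono card_image_le) auto
    finally show ?thesis by (simp add: mult.commute)
  qed
  moreover have "card S \<le> card (W t)" if "fun_space.independent S" "S \<subseteq> forms E (N + t)" for S t
    using fun_space.independent_span_bound[OF fW that(1)] that(2) W by blast
  ultimately show ?thesis by (meson order_trans)
qed

section \<open>Multilinear forms on products of projective spaces\<close>

lemma multi_indices_nth_le: "c \<in> multi_indices ns \<Longrightarrow> r < length ns \<Longrightarrow> c ! r \<le> ns ! r"
  and multi_indices_length: "c \<in> multi_indices ns \<Longrightarrow> length c = length ns"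
  by (auto simp: multi_indices_def)

lemma finite_multi_indices: "finite (multi_indices ns)"
proof (rule finite_subset)
  show "multi_indices ns \<subseteq> {c. set c \<subseteq> {..sum_list ns} \<and> length c = length ns}"
  proof safe
    fix c i assume c: "c \<in> multi_indices ns" and "i \<in> set c"
    then obtain r where "r < length ns" "c ! r = i"
      using multi_indices_length[OF c] by (auto simp: in_set_conv_nth)
    moreover have "ns ! r \<le> sum_list ns" using calculation by (intro member_le_sum_list) simp_all
    ultimately show "i \<le> sum_list ns" using multi_indices_nth_le[OF c, of r] by simp
  qed (simp add: multi_indices_length)
  show "finite {c. set c \<subseteq> {..sum_list ns} \<and> length c = length ns}"
    by (intro finite_lists_length_eq) simp
qed

lemma multi_indices_update:
  "c \<in> multi_indices ns \<Longrightarrow> r < length ns \<Longrightarrow> i \<le> ns ! r \<Longrightarrow> c[r := i] \<in> multi_indices ns"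
  by (auto simp: multi_indices_def nth_list_update)

text \<open>
  Points of a product of projective spaces are given by homogeneous coordinates \<open>x (r, i)\<close>, where \<open>r\<close>
  is the number of the factor. The functions \<open>segre c\<close> are the coordinates of the Segre embedding.
\<close>

definition segre :: "nat list \<Rightarrow> (nat \<times> nat \<Rightarrow> complex) \<Rightarrow> complex" where
  "segre c = (\<lambda>x. \<Prod>r<length c. x (r, c ! r))"

definition multilinear :: "nat list \<Rightarrow> mdmatrix \<Rightarrow> (nat \<times> nat \<Rightarrow> complex) \<Rightarrow> complex" where
  "multilinear ns a = (\<lambda>x. \<Sum>c\<in>multi_indices ns. a c * segre c x)"

definition nonzero_blocks :: "nat list \<Rightarrow> (nat \<times> nat \<Rightarrow> complex) \<Rightarrow> bool" where
  "nonzero_blocks ns x \<longleftrightarrow> (\<forall>r<length ns. \<exists>i\<le>ns ! r. x (r, i) \<noteq> 0)"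

definition variables :: "nat list \<Rightarrow> (nat \<times> nat) set" where
  "variables ns = (SIGMA r:{..<length ns}. {..ns ! r})"

text \<open>
  An index list \<open>c\<close> selects the affine chart where the coordinates \<open>x (r, c ! r)\<close> are nonzero. The map
  \<open>dehom c\<close> parametrises it by setting these coordinates to 1, and \<open>rescale c\<close> normalises
  a point of the chart accordingly.
\<close>

definition dehom :: "nat list \<Rightarrow> (nat \<times> nat \<Rightarrow> complex) \<Rightarrow> nat \<times> nat \<Rightarrow> complex" where
  "dehom c z = (\<lambda>(r, i). if i = c ! r then 1 else z (r, i))"

definition rescale :: "nat list \<Rightarrow> (nat \<times> nat \<Rightarrow> complex) \<Rightarrow> nat \<times> nat \<Rightarrow> complex" where
  "rescale c x = (\<lambda>(r, i). x (r, i) / x (r, c ! r))"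

lemma segre_update:
  assumes "r < length c" "segre c x \<noteq> 0"
  shows "segre (c[r := i]) x = segre c x * rescale c x (r, i)"
proof -
  have nz: "x (r, c ! r) \<noteq> 0"
    using assms by (auto simp: segre_def)
  have "segre (c[r := i]) x = x (r, i) * (\<Prod>k\<in>{..<length c} - {r}. x (k, c ! k))"
    unfolding segre_def using assms(1)
    by (subst prod.remove[of _ r]) (auto intro!: prod.cong)
  moreover have "segre c x = x (r, c ! r) * (\<Prod>k\<in>{..<length c} - {r}. x (k, c ! k))"
    unfolding segre_def using assms(1) by (subst prod.remove[of _ r]) auto
  ultimately show ?thesis using nz by (simp add: rescale_def)
qed

lemma multilinear_dehom_rescale:
  assumes c: "c \<in> multi_indices ns" and nz: "segre c x \<noteq> 0"
  shows "multilinear ns a (dehom c (rescale c x)) = multilinear ns a x / segre c x"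
proof -
  have nzr: "x (r, c ! r) \<noteq> 0" if "r < length ns" for r
    using nz that multi_indices_length[OF c] by (auto simp: segre_def)
  have "segre b (dehom c (rescale c x)) = segre b x / segre c x" if b: "b \<in> multi_indices ns" for b
  proof -
    have "segre b (dehom c (rescale c x)) = (\<Prod>r<length ns. x (r, b ! r) / x (r, c ! r))"
      unfolding segre_def using nzr multi_indices_length[OF b]
      by (intro prod.cong) (auto simp: dehom_def rescale_def)
    then show ?thesis
      using multi_indices_length[OF b] multi_indices_length[OF c] by (simp add: segre_def prod_dividef)
  qed
  then show ?thesis by (simp add: multilinear_def sum_divide_distrib)
qed

lemma multilinear_dehom_poly:
  "(\<lambda>z. multilinear ns a (dehom c z)) \<in> polys (coords (variables ns))"
proof -
  have "(\<lambda>z. multilinear ns a (dehom c z)) =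
      (\<Sum>b\<in>multi_indices ns. scl (a b) (\<Prod>r<length ns. (\<lambda>z. dehom c z (r, b ! r))))"
    by (auto simp: fun_eq_iff pointwise multilinear_def segre_def multi_indices_length intro!: sum.cong)
  also have "\<dots> \<in> polys (coords (variables ns))"
  proof (intro polys_sum polys_scl polys_prod)
    fix b r assume br: "b \<in> multi_indices ns" "r \<in> {..<length ns}"
    show "(\<lambda>z. dehom c z (r, b ! r)) \<in> polys (coords (variables ns))"
    proof (cases "b ! r = c ! r")
      case True
      then have "(\<lambda>z. dehom c z (r, b ! r)) = 1" by (simp add: fun_eq_iff pointwise dehom_def)
      then show ?thesis by (simp add: polys_one)
    next
      case False
      then have "(\<lambda>z. dehom c z (r, b ! r)) \<in> coords (variables ns)"
        using br by (auto simp: dehom_def coords_def variables_def multi_indices_nth_le)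
      then show ?thesis by (rule polys_gen)
    qed
  qed
  finally show ?thesis .
qed

text \<open>
  A coordinate \<open>x (r, i) / x (r, c ! r)\<close> of the chart becomes \<open>segre (c[r := i])\<close> when it is multiplied by
  \<open>segre c\<close>; so one factor \<open>segre c\<close> clears the denominators of each factor in a product.
\<close>

lemma rehomogenize:
  assumes c: "c \<in> multi_indices ns"
    and g: "g \<in> forms (insert 1 (coords (variables ns))) d"
  shows "\<exists>G\<in>forms (segre ` multi_indices ns) d.
           \<forall>x. segre c x \<noteq> 0 \<longrightarrow> G x = segre c x ^ d * g (rescale c x)"
proof -
  let ?S = "segre ` multi_indices ns"
  define H where "H d = {g. \<exists>G\<in>forms ?S d. \<forall>x. segre c x \<noteq> 0 \<longrightarrow> G x = segre c x ^ d * g (rescale c x)}" for d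
  have HI: "g \<in> H d" if "G \<in> forms ?S d" "\<And>x. segre c x \<noteq> 0 \<Longrightarrow> G x = segre c x ^ d * g (rescale c x)" for g G d
    using that by (auto simp: H_def)
  have gen: "e \<in> H 1" if e': "e \<in> insert 1 (coords (variables ns))" for e
  proof (cases "e = 1")
    case True
    show ?thesis
      by (rule HI[of "segre c"]) (use c True in \<open>auto simp: pointwise intro!: generator_mem_forms[unfolded One_nat_def]\<close>)
  next
    case False
    then obtain r i where e: "e = (\<lambda>z. z (r, i))" "r < length ns" "i \<le> ns ! r"
      using e' by (auto simp: coords_def variables_def)
    show ?thesis
    proof (rule HI[of "segre (c[r := i])"])
      show "segre (c[r := i]) \<in> forms ?S 1"
        by (intro generator_mem_forms imageI multi_indices_update c e)
    qed (use e multi_indices_length[OF c] in \<open>simp add: segre_update\<close>)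
  qed
  have prods: "m \<in> H k" if "m \<in> products (insert 1 (coords (variables ns))) k" for m k
    using that
  proof (induction k arbitrary: m)
    case 0
    then show ?case by (intro HI[of 1]) (auto simp: one_mem_forms pointwise)
  next
    case (Suc k)
    then obtain e m' where m: "m = e * m'" "e \<in> insert 1 (coords (variables ns))"
      "m' \<in> products (insert 1 (coords (variables ns))) k"
      by auto
    obtain G where G: "G \<in> forms ?S 1" "\<And>x. segre c x \<noteq> 0 \<Longrightarrow> G x = segre c x ^ 1 * e (rescale c x)"
      using gen[OF m(2)] unfolding H_def by blast
    obtain G' where G': "G' \<in> forms ?S k" "\<And>x. segre c x \<noteq> 0 \<Longrightarrow> G' x = segre c x ^ k * m' (rescale c x)"
      using Suc.IH[OF m(3)] unfolding H_def by blast
    show ?case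
    proof (rule HI)
      show "G * G' \<in> forms ?S (Suc k)" using forms_mult[OF G(1) G'(1)] by simp
    qed (simp add: pointwise G(2) G'(2) m(1))
  qed
  have "g \<in> H d"
    using g unfolding forms_def
  proof (induction rule: fun_space.span_induct_alt)
    case base
    show ?case by (rule HI[of 0]) (auto simp: forms_zero pointwise)
  next
    case (step k f g)
    obtain F where F: "F \<in> forms ?S d" "\<And>x. segre c x \<noteq> 0 \<Longrightarrow> F x = segre c x ^ d * f (rescale c x)"
      using prods[OF step(1)] unfolding H_def by blast
    obtain G where G: "G \<in> forms ?S d" "\<And>x. segre c x \<noteq> 0 \<Longrightarrow> G x = segre c x ^ d * g (rescale c x)"
      using step(2) unfolding H_def by blast
    show ?case
    proof (rule HI)
      show "scl k F + G \<in> forms ?S d" by (intro forms_add forms_scl F G)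
    qed (simp add: pointwise F(2) G(2) algebra_simps)
  qed
  then show ?thesis unfolding H_def by blast
qed

text \<open>
  On the chart of \<open>c\<close> the Nullstellensatz writes \<open>1\<close> as a combination of the dehomogenised forms.
  Homogenising this identity gives a power of \<open>segre c\<close>.
\<close>

lemma segre_power_mem_combs:
  assumes "finite L" and no_zero: "\<And>x. nonzero_blocks ns x \<Longrightarrow> \<exists>l\<in>L. multilinear ns (a l) x \<noteq> 0"
    and c: "c \<in> multi_indices ns"
  shows "\<exists>d. segre c ^ Suc d \<in> combs (segre ` multi_indices ns) L (\<lambda>l. multilinear ns (a l)) d"
proof -
  let ?S = "segre ` multi_indices ns"
  define F where "F l = (\<lambda>z. multilinear ns (a l) (dehom c z))" for l
  have "\<exists>l\<in>L. F l z \<noteq> 0" for z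
    unfolding F_def
  proof (rule no_zero)
    have "c ! r \<le> ns ! r \<and> dehom c z (r, c ! r) \<noteq> 0" if "r < length ns" for r
      using c that by (simp add: dehom_def multi_indices_nth_le)
    then show "nonzero_blocks ns (dehom c z)"
      unfolding nonzero_blocks_def by blast
  qed
  moreover have "finite (variables ns)" by (simp add: variables_def)
  moreover have "F l \<in> polys (coords (variables ns))" for l
    unfolding F_def by (rule multilinear_dehom_poly)
  ultimately have "\<exists>h. (\<forall>l\<in>L. h l \<in> polys (coords (variables ns))) \<and> (\<Sum>l\<in>L. h l * F l) = 1"
    by (intro weak_nullstellensatz \<open>finite L\<close>)
  then obtain h where h: "\<forall>l\<in>L. h l \<in> polys (coords (variables ns))" "(\<Sum>l\<in>L. h l * F l) = 1"
    by blast
  obtain d where d: "\<And>l. l \<in> L \<Longrightarrow> h l \<in> forms (insert 1 (coords (variables ns))) d"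
    by (rule finite_subset_polys[OF \<open>finite L\<close>, of h "coords (variables ns)"]) (use h in auto)
  have "\<forall>l\<in>L. \<exists>G. G \<in> forms ?S d \<and> (\<forall>x. segre c x \<noteq> 0 \<longrightarrow> G x = segre c x ^ d * h l (rescale c x))"
    using rehomogenize[OF c d] by blast
  then obtain G where G: "\<And>l. l \<in> L \<Longrightarrow> G l \<in> forms ?S d"
    "\<And>l x. l \<in> L \<Longrightarrow> segre c x \<noteq> 0 \<Longrightarrow> G l x = segre c x ^ d * h l (rescale c x)"
    by metis
  \<comment> \<open>Clearing denominators costs \<open>d + 1\<close> factors \<open>segre c\<close>; one more makes the identity true outside the chart.\<close>
  have "segre c ^ Suc (Suc d) = (\<Sum>l\<in>L. (segre c * G l) * multilinear ns (a l))"
  proof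
    fix x
    show "(segre c ^ Suc (Suc d)) x = (\<Sum>l\<in>L. (segre c * G l) * multilinear ns (a l)) x"
    proof (cases "segre c x = 0")
      case True
      then show ?thesis by (simp add: pointwise)
    next
      case False
      have "1 = (\<Sum>l\<in>L. h l (rescale c x) * F l (rescale c x))"
        using fun_cong[OF h(2), of "rescale c x"] by (simp add: pointwise)
      also have "\<dots> = (\<Sum>l\<in>L. h l (rescale c x) * multilinear ns (a l) x) / segre c x"
        by (simp add: F_def multilinear_dehom_rescale[OF c False] sum_divide_distrib)
      finally have 1: "segre c x = (\<Sum>l\<in>L. h l (rescale c x) * multilinear ns (a l) x)"
        using False by (simp add: field_simps)
      have "(segre c ^ Suc (Suc d)) x = segre c x * segre c x ^ d * segre c x"
        by (simp add: pointwise)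
      also have "\<dots> = (\<Sum>l\<in>L. segre c x * segre c x ^ d * (h l (rescale c x) * multilinear ns (a l) x))"
        by (subst (3) 1) (simp add: sum_distrib_left)
      also have "\<dots> = (\<Sum>l\<in>L. (segre c * G l) * multilinear ns (a l)) x"
        by (simp add: pointwise G(2)[OF _ False] mult_ac)
      finally show ?thesis .
    qed
  qed
  also have "\<dots> \<in> combs ?S L (\<lambda>l. multilinear ns (a l)) (1 + d)"
    by (intro combsI forms_mult generator_mem_forms imageI c G(1))
  finally show ?thesis by (intro exI[of _ "Suc d"]) simp
qed

section \<open>Common zeros by counting dimensions\<close>

lemma independent_of_dual_points:
  assumes "finite G" and dual: "\<And>a b. a \<in> G \<Longrightarrow> b \<in> G \<Longrightarrow> h a (pt b) \<noteq> 0 \<longleftrightarrow> a = b"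
  shows "inj_on h G" "fun_space.independent (h ` G)"
proof -
  show inj: "inj_on h G"
  proof (rule inj_onI)
    fix a b assume ab: "a \<in> G" "b \<in> G" "h a = h b"
    then have "h a (pt b) \<noteq> 0" using dual[of b b] by simp
    then show "a = b" using dual ab by blast
  qed
  show "fun_space.independent (h ` G)"
  proof (rule fun_space.independent_if_scalars_zero)
    show "finite (h ` G)" using assms by simp
    fix u v assume 0: "(\<Sum>v\<in>h ` G. scl (u v) v) = 0" and "v \<in> h ` G"
    then obtain b where b: "b \<in> G" "v = h b" by blast
    have "0 = (\<Sum>a\<in>G. u (h a) * h a (pt b))"
      using fun_cong[OF 0, of "pt b"] inj by (simp add: sum.reindex pointwise)
    also have "\<dots> = (\<Sum>a\<in>{b}. u (h a) * h a (pt b))"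
      using assms(1) b dual by (intro sum.mono_neutral_right) auto
    finally show "u v = 0" using b dual[OF b(1) b(1)] by simp
  qed
qed

text \<open>
  The points \<open>pt a\<close> form a grid with \<open>s + 1\<close> values for each of the \<open>sum_list ns\<close> affine coordinates of the
  chart where the coordinates \<open>x (r, 0)\<close> are 1. Each point of the grid is separated from the others by the
  product over all coordinates \<open>v\<close> of the \<open>s\<close> linear polynomials that vanish at the wrong values of \<open>v\<close>.
\<close>

lemma many_independent_forms:
  shows "\<exists>S. fun_space.independent S \<and> S \<subseteq> forms (segre ` multi_indices ns) (sum_list ns * s) \<and>
             card S = (s + 1) ^ sum_list ns"
proof -
  let ?S = "segre ` multi_indices ns"
  define V where "V = (SIGMA r:{..<length ns}. {1..ns ! r})"
  have cardV: "card V = sum_list ns" and "finite V"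
    by (simp_all add: V_def sum_list_sum_nth atLeast0LessThan)
  define G where "G = PiE V (\<lambda>_. {..s})"
  define o' where "o' = replicate (length ns) (0::nat)"
  have o': "o' \<in> multi_indices ns" by (simp add: o'_def multi_indices_def)
  \<comment> \<open>The form \<open>(x (r, i) - b * x (r, 0)) * (\<Prod>q \<noteq> r. x (q, 0))\<close>, which is \<open>x (r, i) - b\<close> on the chart.\<close>
  define lin where "lin = (\<lambda>((r, i), b). segre (o'[r := i]) - scl (of_nat b) (segre o'))"
  define pt where "pt a = (\<lambda>(r, i). if i = 0 then 1 else of_nat (a (r, i)) :: complex)" for a :: "nat \<times> nat \<Rightarrow> nat"
  define I where "I a = (SIGMA v:V. {..s} - {a v})" for a
  define h where "h a = (\<Prod>i\<in>I a. lin i)" for a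
  have s0: "segre o' (pt a) = 1" for a
    by (simp add: segre_def o'_def pt_def)
  have lin_pt: "lin (v, b) (pt a) = of_nat (a v) - of_nat b" if vV: "v \<in> V" for v b a
  proof -
    obtain r i where v: "v = (r, i)" "r < length ns" "1 \<le> i" using vV by (auto simp: V_def)
    have "segre (o'[r := i]) (pt a) = of_nat (a v)"
      using v s0 by (subst segre_update) (auto simp: o'_def rescale_def pt_def)
    then show ?thesis by (simp add: lin_def v pointwise s0)
  qed
  have lin_forms: "lin (v, b) \<in> forms ?S 1" if vV: "v \<in> V" for v b
  proof -
    obtain r i where v: "v = (r, i)" "r < length ns" "i \<le> ns ! r" using vV by (auto simp: V_def)
    show ?thesis
      unfolding lin_def v(1) prod.case
      by (intro forms_diff forms_scl generator_mem_forms imageI multi_indices_update o' v)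
  qed
  have finI: "finite (I a)" for a using \<open>finite V\<close> by (simp add: I_def)
  have "h a \<in> forms ?S (sum_list ns * s)" if "a \<in> G" for a
  proof -
    have "card (I a) = (\<Sum>v\<in>V. card ({..s} - {a v}))"
      unfolding I_def using \<open>finite V\<close> by (subst card_SigmaI) auto
    also have "\<dots> = (\<Sum>v\<in>V. s)"
      using that by (intro sum.cong) (auto simp: G_def PiE_def Pi_def)
    finally have "card (I a) = sum_list ns * s" using cardV by simp
    moreover have "h a \<in> forms ?S (card (I a))"
      unfolding h_def by (intro forms_prod finI) (auto simp: I_def lin_forms[unfolded One_nat_def])
    ultimately show ?thesis by simp
  qed
  moreover have "h a (pt b) \<noteq> 0 \<longleftrightarrow> a = b" if "a \<in> G" "b \<in> G" for a b
  proof -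
    have bs: "b v \<le> s" if "v \<in> V" for v
      using PiE_mem[of b V "\<lambda>_. {..s}" v] \<open>b \<in> G\<close> that by (simp add: G_def)
    have "h a (pt b) = (\<Prod>(v, k)\<in>I a. of_nat (b v) - of_nat k)"
      unfolding h_def prod_fun_apply by (intro prod.cong) (auto simp: I_def lin_pt)
    then have "h a (pt b) \<noteq> 0 \<longleftrightarrow> (\<forall>(v, k)\<in>I a. b v \<noteq> k)"
      using finI by (auto simp: prod_zero_iff split_beta)
    also have "\<dots> \<longleftrightarrow> (\<forall>v\<in>V. b v = a v)"
      using bs by (fastforce simp: I_def)
    also have "\<dots> \<longleftrightarrow> a = b"
      using that PiE_ext[of b V "\<lambda>_. {..s}" a] by (auto simp: G_def)
    finally show ?thesis .
  qed
  moreover have "finite G" unfolding G_def using \<open>finite V\<close> by (intro finite_PiE) auto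
  moreover have "card G = (s + 1) ^ sum_list ns"
    unfolding G_def using \<open>finite V\<close> by (simp add: card_PiE cardV)
  ultimately show ?thesis
    using independent_of_dual_points[of G h pt] by (intro exI[of _ "h ` G"]) (auto simp: card_image)
qed

text \<open>
  Without a common zero, the growth of the dimension of the space of forms of degree \<open>d\<close> would be bounded by
  \<open>d ^ (card L - 1)\<close>, which is incompatible with the lower bound \<open>d ^ sum_list ns\<close>.
\<close>

theorem common_zero:
  assumes "finite L" "card L \<le> sum_list ns"
  shows "\<exists>x. nonzero_blocks ns x \<and> (\<forall>l\<in>L. multilinear ns (a l) x = 0)"
proof (cases "L = {}")
  case True
  then show ?thesis by (intro exI[of _ "\<lambda>_. 1"]) (auto simp: nonzero_blocks_def)
next
  case False
  show ?thesis
  proof (rule ccontr)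
    assume no: "\<not> ?thesis"
    let ?E = "segre ` multi_indices ns" and ?n = "sum_list ns"
    have no_zero: "\<exists>l\<in>L. multilinear ns (a l) x \<noteq> 0" if "nonzero_blocks ns x" for x
      using no that by blast
    have "\<exists>N B. \<forall>t S. fun_space.independent S \<longrightarrow> S \<subseteq> forms ?E (N + t) \<longrightarrow>
        card S \<le> B * (t + 1) ^ (card L - 1)"
    proof (rule growth_bound)
      show "\<exists>d. e ^ Suc d \<in> combs ?E L (\<lambda>l. multilinear ns (a l)) d" if "e \<in> ?E" for e
        using that segre_power_mem_combs[OF \<open>finite L\<close> no_zero] by auto
    qed (use finite_multi_indices \<open>finite L\<close> False in auto)
    then obtain N B where NB: "\<forall>t S. fun_space.independent S \<longrightarrow> S \<subseteq> forms ?E (N + t) \<longrightarrow>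
        card S \<le> B * (t + 1) ^ (card L - 1)"
      by (elim exE)
    have "0 < card L" using assms False by (simp add: card_gt_0_iff)
    then have n: "?n \<ge> 1" using assms by linarith
    \<comment> \<open>Degree \<open>?n * s\<close> is beyond \<open>N\<close>, and the upper bound for \<open>(s + 1) ^ ?n\<close> becomes \<open>s * (s + 1) ^ (?n - 1)\<close> at most.\<close>
    define s where "s = N + B * ?n ^ (?n - 1)"
    define t where "t = ?n * s - N"
    have "1 * s \<le> ?n * s" using n by (rule mult_le_mono1)
    moreover have "N \<le> s" by (simp add: s_def)
    ultimately have "N \<le> ?n * s" by linarith
    then have Nt: "?n * s = N + t" by (simp add: t_def)
    obtain S where S: "fun_space.independent S" "S \<subseteq> forms ?E (N + t)" "card S = (s + 1) ^ ?n"
      using many_independent_forms[of ns s] unfolding Nt by blast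
    then have "(s + 1) ^ ?n \<le> B * (t + 1) ^ (card L - 1)" using NB[rule_format, OF S(1,2)] by simp
    also have "\<dots> \<le> B * (t + 1) ^ (?n - 1)"
      using assms(2) by (intro mult_le_mono2 power_increasing) auto
    also have "\<dots> \<le> B * (?n * (s + 1)) ^ (?n - 1)"
      using n by (intro mult_le_mono2 power_mono) (auto simp: t_def)
    also have "\<dots> = (B * ?n ^ (?n - 1)) * (s + 1) ^ (?n - 1)" by (simp only: power_mult_distrib mult.assoc)
    also have "\<dots> < (s + 1) * (s + 1) ^ (?n - 1)"
      by (intro mult_strict_right_mono) (auto simp: s_def)
    also have "\<dots> = (s + 1) ^ ?n" using n by (simp flip: power_Suc)
    finally show False by simp
  qed
qed

section \<open>Contraction of a matrix with vectors\<close>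

text \<open>
  The sum of \<open>a c * (\<Prod>r. xs ! r (c ! r))\<close> over all index lists \<open>c\<close>, in a recursive form that needs no
  positions: replacing a block of indices then amounts to splitting lists (\<open>contract_append\<close>).
\<close>

fun contract :: "nat list \<Rightarrow> mdmatrix \<Rightarrow> (nat \<Rightarrow> complex) list \<Rightarrow> complex" where
  "contract [] a xs = a []"
| "contract (n # ns) a xs = (\<Sum>i\<le>n. hd xs i * contract ns (\<lambda>c. a (i # c)) (tl xs))"

lemma contract_cong:
  "(\<And>c. length c = length ns \<Longrightarrow> a c = b c) \<Longrightarrow> contract ns a xs = contract ns b xs"
proof (induction ns arbitrary: a b xs)
  case (Cons n ns)
  have "contract ns (\<lambda>c. a (i # c)) (tl xs) = contract ns (\<lambda>c. b (i # c)) (tl xs)" for i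
    by (rule Cons.IH) (simp add: Cons.prems)
  then show ?case by simp
qed simp

lemma contract_sum:
  "contract ns (\<lambda>c. \<Sum>h\<in>H. s h * a h c) xs = (\<Sum>h\<in>H. s h * contract ns (a h) xs)"
proof (induction ns arbitrary: a xs)
  case (Cons n ns)
  show ?case
    by (simp add: Cons sum_distrib_left, subst sum.swap) (simp add: mult_ac)
qed simp

lemma contract_scale: "contract ns (\<lambda>c. s * a c) xs = s * contract ns a xs"
  using contract_sum[where H = "{()}" and s = "\<lambda>_. s" and a = "\<lambda>_. a"] by simp

lemma contract_append:
  "length xs = length ns \<Longrightarrow>
    contract (ns @ ms) a (xs @ ys) = contract ns (\<lambda>c. contract ms (\<lambda>d. a (c @ d)) ys) xs"
proof (induction ns arbitrary: a xs)
  case (Cons n ns)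
  then obtain x xs' where "xs = x # xs'" by (cases xs) auto
  then show ?case using Cons by (auto intro!: sum.cong)
qed auto

lemma multi_indices_Nil [simp]: "multi_indices [] = {[]}"
  by (auto simp: multi_indices_def)

lemma multi_indices_Cons: "multi_indices (n # ns) = (\<lambda>(i, c). i # c) ` ({..n} \<times> multi_indices ns)"
proof (intro set_eqI iffI)
  fix d assume "d \<in> multi_indices (n # ns)"
  then obtain i c where d: "d = i # c" "length c = length ns" "\<forall>r<Suc (length ns). d ! r \<le> (n # ns) ! r"
    by (auto simp: multi_indices_def length_Suc_conv)
  have "i \<le> n" using d(3)[rule_format, of 0] d(1) by simp
  moreover have "\<forall>r<length ns. c ! r \<le> ns ! r" using d(3)[rule_format, of "Suc _"] d(1) by auto
  ultimately show "d \<in> (\<lambda>(i, c). i # c) ` ({..n} \<times> multi_indices ns)"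
    using d by (auto simp: multi_indices_def)
qed (auto simp: multi_indices_def nth_Cons split: nat.split)

lemma contract_eq_sum:
  "contract ns a (map x [0..<length ns]) = (\<Sum>c\<in>multi_indices ns. a c * (\<Prod>r<length ns. x r (c ! r)))"
proof (induction ns arbitrary: a x)
  case (Cons n ns)
  have *: "map x [0..<length (n # ns)] = x 0 # map (\<lambda>r. x (Suc r)) [0..<length ns]"
    by (simp add: upt_conv_Cons map_Suc_upt[symmetric] comp_def del: upt_Suc)
  have inj: "inj_on (\<lambda>(i, c). i # c) ({..n} \<times> multi_indices ns)"
    by (auto simp: inj_on_def)
  have "(\<Sum>d\<in>multi_indices (n # ns). a d * (\<Prod>r<length (n # ns). x r (d ! r))) =
      (\<Sum>(i, c)\<in>{..n} \<times> multi_indices ns. a (i # c) * (x 0 i * (\<Prod>r<length ns. x (Suc r) (c ! r))))"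
    unfolding multi_indices_Cons sum.reindex[OF inj]
    by (auto intro!: sum.cong simp: prod.lessThan_Suc_shift simp del: prod.lessThan_Suc)
  also have "\<dots> = contract (n # ns) a (map x [0..<length (n # ns)])"
    unfolding * by (simp add: Cons sum.cartesian_product[symmetric] sum_distrib_left mult_ac)
  finally show ?case ..
qed simp

abbreviation nonzero_upto :: "nat \<Rightarrow> (nat \<Rightarrow> complex) \<Rightarrow> bool" where
  "nonzero_upto n x \<equiv> \<exists>i\<le>n. x i \<noteq> 0"

lemma degenerate_Cons_iff:
  "degenerate (k # ns) A \<longleftrightarrow>
    (\<exists>xs. list_all2 nonzero_upto ns xs \<and> (\<forall>h\<le>k. contract ns (\<lambda>c. A (h # c)) xs = 0))"
proof -
  have eq: "(\<Sum>idx\<in>{idx \<in> multi_indices (k # ns). idx ! 0 = h}.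
       A idx * (\<Prod>r = 1..<length (k # ns). x r (idx ! r))) =
     contract ns (\<lambda>c. A (h # c)) (map (\<lambda>r. x (Suc r)) [0..<length ns])" if h: "h \<le> k" for h and x :: "nat \<Rightarrow> nat \<Rightarrow> complex"
  proof -
    have idx: "{idx \<in> multi_indices (k # ns). idx ! 0 = h} = (#) h ` multi_indices ns"
      using h by (auto simp: multi_indices_Cons)
    have prod: "(\<Prod>r = 1..<length (k # ns). x r ((h # c) ! r)) = (\<Prod>r<length ns. x (Suc r) (c ! r))" for c
      using prod.shift_bounds_Suc_ivl[of "\<lambda>r. x r ((h # c) ! r)" 0 "length ns"]
      by (simp add: atLeast0LessThan del: prod.shift_bounds_Suc_ivl prod.op_ivl_Suc)
    show ?thesis
      unfolding idx contract_eq_sum by (subst sum.reindex) (simp_all only: inj_on_Cons1 o_def prod)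
  qed
  show ?thesis
  proof
    assume "degenerate (k # ns) A"
    then obtain x where x: "\<forall>r\<in>{1..<length (k # ns)}. \<exists>i\<le>(k # ns) ! r. x r i \<noteq> 0"
      "\<forall>h\<le>k. contract ns (\<lambda>c. A (h # c)) (map (\<lambda>r. x (Suc r)) [0..<length ns]) = 0"
      unfolding degenerate_def using eq by auto
    have "nonzero_upto (ns ! r) (x (Suc r))" if "r < length ns" for r
      using x(1)[rule_format, of "Suc r"] that by auto
    then have "list_all2 nonzero_upto ns (map (\<lambda>r. x (Suc r)) [0..<length ns])"
      by (auto simp: list_all2_conv_all_nth)
    with x(2) show "\<exists>xs. list_all2 nonzero_upto ns xs \<and> (\<forall>h\<le>k. contract ns (\<lambda>c. A (h # c)) xs = 0)"
      by blast
  next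
    assume "\<exists>xs. list_all2 nonzero_upto ns xs \<and> (\<forall>h\<le>k. contract ns (\<lambda>c. A (h # c)) xs = 0)"
    then obtain xs where xs: "list_all2 nonzero_upto ns xs" "\<forall>h\<le>k. contract ns (\<lambda>c. A (h # c)) xs = 0"
      by blast
    define x where "x r = xs ! (r - 1)" for r
    have len: "length xs = length ns" using xs(1) by (simp add: list_all2_lengthD)
    have "map (\<lambda>r. x (Suc r)) [0..<length ns] = xs"
      unfolding x_def len[symmetric] by (simp add: map_nth)
    then have "\<forall>h\<le>k. contract ns (\<lambda>c. A (h # c)) (map (\<lambda>r. x (Suc r)) [0..<length ns]) = 0"
      using xs(2) by simp
    moreover have "\<exists>i\<le>(k # ns) ! r. x r i \<noteq> 0" if "r \<in> {1..<length (k # ns)}" for r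
      using xs(1) that by (cases r) (auto simp: list_all2_conv_all_nth x_def)
    ultimately show "degenerate (k # ns) A"
      unfolding degenerate_def using eq by (intro exI[of _ x]) auto
  qed
qed

text \<open>
  With \<open>z h0 \<noteq> 0\<close>, the vector \<open>v\<close> is a multiple of \<open>z\<close> if and only if \<open>z h0 * v h = z h * v h0\<close> for the \<open>k\<close>
  indices \<open>h \<noteq> h0\<close>. For the contraction \<open>v\<close> of \<open>A\<close> these are \<open>k\<close> multilinear equations, solvable by
  \<open>common_zero\<close>. The scalar \<open>s\<close> is zero if \<open>A\<close> is degenerate at \<open>xs\<close>.
\<close>

lemma contraction_hits_every_line:
  assumes "sum_list ns = k" and "nonzero_upto k z"
  shows "\<exists>xs s. list_all2 nonzero_upto ns xs \<and> (\<forall>h\<le>k. contract ns (\<lambda>c. A (h # c)) xs = s * z h)"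
proof -
  obtain h0 where h0: "h0 \<le> k" "z h0 \<noteq> 0" using assms(2) by blast
  define a where "a h c = z h0 * A (h # c) - z h * A (h0 # c)" for h c
  obtain x where x: "nonzero_blocks ns x" "\<forall>h\<in>{..k} - {h0}. multilinear ns (a h) x = 0"
    using common_zero[of "{..k} - {h0}" ns a] assms(1) h0(1) by auto
  define xs where "xs = map (\<lambda>r i. x (r, i)) [0..<length ns]"
  have contract_xs: "contract ns b xs = multilinear ns b x" for b
    unfolding xs_def contract_eq_sum multilinear_def segre_def
    by (intro sum.cong) (auto simp: multi_indices_length)
  have split: "multilinear ns (a h) x =
      z h0 * contract ns (\<lambda>c. A (h # c)) xs - z h * contract ns (\<lambda>c. A (h0 # c)) xs" for h
    by (simp add: contract_xs multilinear_def a_def algebra_simps sum_subtractf sum_distrib_left)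
  define s where "s = contract ns (\<lambda>c. A (h0 # c)) xs / z h0"
  have "contract ns (\<lambda>c. A (h # c)) xs = s * z h" if "h \<le> k" for h
  proof (cases "h = h0")
    case True
    then show ?thesis using h0 by (simp add: s_def)
  next
    case False
    then have "multilinear ns (a h) x = 0" using x(2) that by simp
    then show ?thesis using h0(2) by (simp add: split s_def field_simps)
  qed
  moreover have "list_all2 nonzero_upto ns xs"
    using x(1) by (auto simp: xs_def list_all2_conv_all_nth nonzero_blocks_def)
  ultimately show ?thesis by blast
qed

section \<open>Degeneracy of convolutions\<close>

lemma contract_convolution:
  assumes len: "length us = length ms" "length xs = length ns"
  shows "contract (ms @ ns @ ms') (\<lambda>d. convolution (k # ns) 0 (Suc (length ms)) A B (j0 # d)) (us @ xs @ vs) =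
    contract (ms @ k # ms') (\<lambda>d. B (j0 # d)) (us @ (\<lambda>h. contract ns (\<lambda>c. A (h # c)) xs) # vs)"
proof -
  have "contract ns (\<lambda>c. contract ms' (\<lambda>e. convolution (k # ns) 0 (Suc (length ms)) A B (j0 # d @ c @ e)) vs) xs =
      (\<Sum>h\<le>k. contract ns (\<lambda>c. A (h # c)) xs * contract ms' (\<lambda>e. B (j0 # d @ h # e)) vs)"
    if d: "length d = length ms" for d
  proof -
    have conv: "convolution (k # ns) 0 (Suc (length ms)) A B (j0 # d @ c @ e) =
        (\<Sum>h\<le>k. A (h # c) * B (j0 # d @ h # e))" if "length c = length ns" for c e
      using convolution_0_apply[of "k # ns" "length ns" c "j0 # d" "Suc (length ms)" A B e] d that by simp
    have "contract ns (\<lambda>c. contract ms' (\<lambda>e. convolution (k # ns) 0 (Suc (length ms)) A B (j0 # d @ c @ e)) vs) xs =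
        contract ns (\<lambda>c. \<Sum>h\<le>k. contract ms' (\<lambda>e. B (j0 # d @ h # e)) vs * A (h # c)) xs"
      by (rule contract_cong) (simp add: conv contract_sum mult.commute)
    also have "\<dots> = (\<Sum>h\<le>k. contract ms' (\<lambda>e. B (j0 # d @ h # e)) vs * contract ns (\<lambda>c. A (h # c)) xs)"
      by (rule contract_sum)
    finally show ?thesis by (simp only: mult.commute)
  qed
  then show ?thesis
    by (simp add: contract_append len) (rule contract_cong, simp)
qed

lemma contract_scale_vector:
  assumes "length us = length ms" and z: "\<And>h. h \<le> k \<Longrightarrow> z h = s * w h"
  shows "contract (ms @ k # ms') b (us @ z # vs) = s * contract (ms @ k # ms') b (us @ w # vs)"
proof -
  have "(\<Sum>h\<le>k. z h * g h) = s * (\<Sum>h\<le>k. w h * g h)" for g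
    by (simp add: z sum_distrib_left mult.assoc)
  then show ?thesis by (simp add: contract_append[OF assms(1)] contract_scale)
qed

lemma nonzero_upto_ones: "list_all2 nonzero_upto ns (replicate (length ns) (\<lambda>_. 1))"
  by (auto simp: list_all2_conv_all_nth)

text \<open>
  If \<open>A\<close> is degenerate, the vectors at the positions of \<open>B\<close> are arbitrary, and vectors of ones are taken. If
  \<open>B\<close> is degenerate, the vector at the position of the index \<open>k\<close> is traded for vectors that \<open>A\<close>
  contracts to a multiple of it.
\<close>

theorem degenerate_convolution_iff:
  assumes "k = sum_list ns"
  shows "degenerate (l0 # ms @ ns @ ms') (convolution (k # ns) 0 (Suc (length ms)) A B) \<longleftrightarrow>
    degenerate (k # ns) A \<or> degenerate (l0 # ms @ k # ms') B"
    (is "degenerate ?fmt ?C \<longleftrightarrow> _")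
proof
  assume "degenerate ?fmt ?C"
  then obtain ys where ys: "list_all2 nonzero_upto (ms @ ns @ ms') ys"
    "\<forall>j\<le>l0. contract (ms @ ns @ ms') (\<lambda>d. ?C (j # d)) ys = 0"
    unfolding degenerate_Cons_iff by blast
  obtain us xs vs where uxv: "ys = us @ xs @ vs" "list_all2 nonzero_upto ms us"
    "list_all2 nonzero_upto ns xs" "list_all2 nonzero_upto ms' vs"
    using ys(1) by (auto simp: list_all2_append1)
  define z where "z h = contract ns (\<lambda>c. A (h # c)) xs" for h
  show "degenerate (k # ns) A \<or> degenerate (l0 # ms @ k # ms') B"
  proof (cases "nonzero_upto k z")
    case True
    have "list_all2 nonzero_upto (ms @ k # ms') (us @ z # vs)"
      using uxv True by (auto intro: list_all2_appendI)
    moreover have "\<forall>j\<le>l0. contract (ms @ k # ms') (\<lambda>d. B (j # d)) (us @ z # vs) = 0"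
      using ys(2) contract_convolution[of us ms xs ns ms' k A B _ vs] uxv
      by (simp add: list_all2_lengthD z_def[abs_def])
    ultimately show ?thesis unfolding degenerate_Cons_iff by blast
  next
    case False
    then show ?thesis using uxv(3) unfolding degenerate_Cons_iff z_def by blast
  qed
next
  have degI: "degenerate ?fmt ?C"
    if "list_all2 nonzero_upto ms us" "list_all2 nonzero_upto ns xs" "list_all2 nonzero_upto ms' vs"
      and z: "\<And>h. h \<le> k \<Longrightarrow> contract ns (\<lambda>c. A (h # c)) xs = s * z h"
      and 0: "\<And>j. j \<le> l0 \<Longrightarrow> s * contract (ms @ k # ms') (\<lambda>d. B (j # d)) (us @ z # vs) = 0"
    for us xs vs s z
  proof -
    have len: "length us = length ms" "length xs = length ns"
      using that(1,2) by (simp_all add: list_all2_lengthD)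
    have "contract (ms @ ns @ ms') (\<lambda>d. ?C (j # d)) (us @ xs @ vs) = 0" if j: "j \<le> l0" for j
    proof -
      note contract_convolution[OF len]
      also have "contract (ms @ k # ms') (\<lambda>d. B (j # d)) (us @ (\<lambda>h. contract ns (\<lambda>c. A (h # c)) xs) # vs) =
          s * contract (ms @ k # ms') (\<lambda>d. B (j # d)) (us @ z # vs)" for j
        by (rule contract_scale_vector[OF len(1) z])
      finally show ?thesis using 0[OF j] by simp
    qed
    moreover have "list_all2 nonzero_upto (ms @ ns @ ms') (us @ xs @ vs)"
      using that(1-3) by (intro list_all2_appendI)
    ultimately show ?thesis unfolding degenerate_Cons_iff by blast
  qed
  assume "degenerate (k # ns) A \<or> degenerate (l0 # ms @ k # ms') B"
  then show "degenerate ?fmt ?C"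
  proof
    assume "degenerate (k # ns) A"
    then obtain xs where "list_all2 nonzero_upto ns xs" "\<forall>h\<le>k. contract ns (\<lambda>c. A (h # c)) xs = 0"
      unfolding degenerate_Cons_iff by blast
    then show ?thesis
      using degI[OF nonzero_upto_ones _ nonzero_upto_ones, of xs 0] by simp
  next
    assume "degenerate (l0 # ms @ k # ms') B"
    then obtain ys where ys: "list_all2 nonzero_upto (ms @ k # ms') ys"
      "\<forall>j\<le>l0. contract (ms @ k # ms') (\<lambda>d. B (j # d)) ys = 0"
      unfolding degenerate_Cons_iff by blast
    obtain us z vs where uzv: "ys = us @ z # vs" "list_all2 nonzero_upto ms us"
      "nonzero_upto k z" "list_all2 nonzero_upto ms' vs"
      using ys(1) by (auto simp: list_all2_append1 list_all2_Cons1)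
    obtain xs s where "list_all2 nonzero_upto ns xs"
      "\<forall>h\<le>k. contract ns (\<lambda>c. A (h # c)) xs = s * z h"
      using contraction_hits_every_line[OF assms[symmetric] uzv(3), of A] by blast
    then show ?thesis using degI[of us xs vs s z] uzv ys(2) by simp
  qed
qed

lemma boundary_format_Cons: "boundary_format (k # ns) \<longleftrightarrow> k = sum_list ns"
  unfolding boundary_format_def
  using sum.shift_bounds_Suc_ivl[of "\<lambda>r. (k # ns) ! r" 0 "length ns"]
  by (simp add: sum_list_sum_nth del: sum.op_ivl_Suc sum.shift_bounds_Suc_ivl)

theorem corollary4p5:
  fixes p q j :: nat and ks ls :: "nat list" and A B :: mdmatrix
  assumes "p \<ge> 1" and "q \<ge> 1"
    and "length ks = p + 1" and "length ls = q + 1"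
    and "boundary_format ks" and "boundary_format ls"
    and "1 \<le> j" and "j \<le> q" and "ks ! 0 = ls ! j"
  shows "nondegenerate ks A \<and> nondegenerate ls B \<longleftrightarrow>
         nondegenerate (conv_format ks ls 0 j) (convolution ks 0 j A B)"
proof -
  obtain k ns where ks: "ks = k # ns"
    using assms(3) by (cases ks) auto
  obtain l0 ls' where ls': "ls = l0 # ls'"
    using assms(4) by (cases ls) auto
  obtain i where i: "j = Suc i" using assms(7) by (cases j) auto
  define ms ms' where "ms = take i ls'" and "ms' = drop (Suc i) ls'"
  have "i < length ls'" using assms(4,8) ls' i by simp
  then have ls: "ls = l0 # ms @ k # ms'" and j: "j = Suc (length ms)"
    using assms(9) id_take_nth_drop[of i ls'] by (simp_all add: ls' ks i ms_def ms'_def)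
  have "k = sum_list ns" using assms(5) by (simp add: ks boundary_format_Cons)
  from degenerate_convolution_iff[OF this, of l0 ms ms' A B]
  show ?thesis by (simp add: ks ls j conv_format_def)
qed

end
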